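(* Let $\mathcal{Y}$ be a reflexive separable Banach space and $\mathcal{H}$ a separable Hilbert space such that $\mathcal{Y}$ is compactly embedded into $\mathcal{H}$, and consider the induced Gelfand triple $\mathcal{Y}\hookrightarrow\mathcal{H}\hookrightarrow\mathcal{Y}^*$. For some fixed $T>0$ let $\Psi^n:\Omega\to C([0,T];\mathcal{H})$, $n\in\mathbb{N}$, be a sequence of measurable processes such that for every $t\in[0,T]$, $$\sup_{n\in\mathbb{N}}\mathbb{E}\Big(\sup_{t\in[0,T]}\|\Psi^n_t\|_{\mathcal{H}}\Big)<\infty$$ and for any sequence of stopping times $(\gamma_n)$ with $\gamma_n:\Omega\to[0,T]$, and any $\varepsilon>0$, $y\in\mathcal{Y}$, $$\lim_{\delta\to0^+}\sup_{n\in\mathbb{N}}\mathbb{P}\Big(\Big\{\omega\in\Omega:\big|\langle\Psi^n_{(\gamma_n+\delta)\wedge T}-\Psi^n_{\gamma_n},y\rangle_{\mathcal{H}}\big|>\varepsilon\Big\}\Big)=0.$$ Then the sequence of the laws of $(\Psi^n)$ is tight in the space of probability measures over $\mathcal{D}([0,T];\mathcal{Y}^* )$.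
   Context: $(\Omega,\mathcal{F},(\mathcal{F}_t)_{t\ge0},\mathbb{P})$ is a fixed filtered probability space, complete with respect to $\mathcal{F}_0$; stopping times are with respect to $(\mathcal{F}_t)$. Banach spaces carry their Borel $\sigma$-algebras. $C([0,T];\mathcal{H})$ is the space of continuous functions from $[0,T]$ into $\mathcal{H}$. Gelfand triple means that $\mathcal{Y}$ is densely embedded in $\mathcal{H}$, $\mathcal{H}$ is identified with its dual, and $\mathcal{H}$ embeds into the dual space $\mathcal{Y}^*$ by $\langle h,y\rangle_{\mathcal{Y}^*\times\mathcal{Y}}=\langle h,y\rangle_{\mathcal{H}}$. $\mathcal{D}([0,T];\mathcal{Y}^* )$ is the space of càdlàg functions $[0,T]\to\mathcal{Y}^*$ with the Skorohod topology, induced by the metric $d(\phi,\psi)=\inf_\eta\big[\sup_{t\in[0,T]}|\eta(t)-t|\vee\sup_{t\in[0,T]}\|\phi(t)-\psi(\eta(t))\|_{\mathcal{Y}^*}\big]$, the infimum being over strictly increasing continuous maps $\eta$ of $[0,T]$ onto itself.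
   Formalization: The processes Ψ^n are additionally assumed adapted to (F_t); without this the claim fails, e.g. for ramps of slope n starting at a uniform random time when every F_t is trivial. *)

theory Defs
  imports "HOL-Probability.Probability"
begin

(* The library indexes a real-time filtration by all of the reals.  Only times t >= 0 carry
   information: a family given for t >= 0 extends by F t = F 0 for t < 0, and for nonnegative
   random times the condition in stopping_time is vacuous at negative t. *)
locale filtered_prob_space = prob_space M + filtration "space M" F
  for M :: "'a measure" and F :: "real \<Rightarrow> 'a measure" +
  assumes subalg: "\<And>t. subalgebra M (F t)"
    and complete_F0: "\<And>N A. N \<in> null_sets M \<Longrightarrow> A \<subseteq> N \<Longrightarrow> A \<in> sets (F 0)"

definition borel_of :: "'a topology \<Rightarrow> 'a measure" where
  "borel_of X = sigma (topspace X) {U. openin X U}"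

(* The bound is put on K itself, so the definition never evaluates a measure to the default
   value 0 on a non-measurable set in favour of tightness. *)
definition tight_family :: "'a topology \<Rightarrow> 'a measure set \<Rightarrow> bool" where
  "tight_family X P \<longleftrightarrow>
     (\<forall>\<mu>\<in>P. prob_space \<mu> \<and> sets \<mu> = sets (borel_of X)) \<and>
     (\<forall>\<epsilon>>0. \<exists>K. compactin X K \<and> (\<forall>\<mu>\<in>P. measure \<mu> K > 1 - \<epsilon>))"

definition reflexive_space :: "'y::real_normed_vector itself \<Rightarrow> bool" where
  "reflexive_space _ \<longleftrightarrow>
     (\<forall>\<Phi> :: ('y \<Rightarrow>\<^sub>L real) \<Rightarrow>\<^sub>L real. \<exists>y. \<forall>f. blinfun_apply \<Phi> f = blinfun_apply f y)"

definition compact_embedding ::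
    "('y::real_normed_vector \<Rightarrow>\<^sub>L 'h::real_normed_vector) \<Rightarrow> bool" where
  "compact_embedding i \<longleftrightarrow>
     inj (blinfun_apply i) \<and> (\<forall>B. bounded B \<longrightarrow> compact (closure (blinfun_apply i ` B)))"

definition dense_embedding ::
    "('y::real_normed_vector \<Rightarrow>\<^sub>L 'h::real_normed_vector) \<Rightarrow> bool" where
  "dense_embedding i \<longleftrightarrow> inj (blinfun_apply i) \<and> closure (range (blinfun_apply i)) = UNIV"

(* The embedding of H into the dual of Y: h is sent to the functional y \<mapsto> h \<bullet> i y. *)
definition gelfand_dual ::
    "('y::real_normed_vector \<Rightarrow>\<^sub>L 'h::real_inner) \<Rightarrow> 'h \<Rightarrow> ('y \<Rightarrow>\<^sub>L real)" where
  "gelfand_dual i h = blinfun_inner_right h o\<^sub>L i"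

definition C_metric :: "real \<Rightarrow> (real \<Rightarrow> 'h::metric_space) metric" where
  "C_metric T = cfunspace (top_of_set {0..T}) euclidean_metric"

definition cadlag_space :: "real \<Rightarrow> (real \<Rightarrow> 'b::topological_space) set" where
  "cadlag_space T =
     {\<phi> \<in> extensional {0..T}.
        (\<forall>t\<in>{0..<T}. (\<phi> \<longlongrightarrow> \<phi> t) (at_right t)) \<and>
        (\<forall>t\<in>{0<..T}. \<exists>l. (\<phi> \<longlongrightarrow> l) (at_left t))}"

definition time_changes :: "real \<Rightarrow> (real \<Rightarrow> real) set" where
  "time_changes T =
     {\<eta>. strict_mono_on {0..T} \<eta> \<and> continuous_on {0..T} \<eta> \<and> \<eta> ` {0..T} = {0..T}}"

definition skorohod_dist ::
    "real \<Rightarrow> (real \<Rightarrow> 'b::real_normed_vector) \<Rightarrow> (real \<Rightarrow> 'b) \<Rightarrow> real" where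
  "skorohod_dist T \<phi> \<psi> =
     (INF \<eta>\<in>time_changes T.
        max (SUP t\<in>{0..T}. \<bar>\<eta> t - t\<bar>) (SUP t\<in>{0..T}. norm (\<phi> t - \<psi> (\<eta> t))))"

definition skorohod_topology :: "real \<Rightarrow> (real \<Rightarrow> 'b::real_normed_vector) topology" where
  "skorohod_topology T = Metric_space.mtopology (cadlag_space T) (skorohod_dist T)"

definition skorohod_law ::
    "'a measure \<Rightarrow> real \<Rightarrow> ('y::real_normed_vector \<Rightarrow>\<^sub>L 'h::real_inner) \<Rightarrow>
     ('a \<Rightarrow> real \<Rightarrow> 'h) \<Rightarrow> (real \<Rightarrow> ('y \<Rightarrow>\<^sub>L real)) measure" where
  "skorohod_law M T i X =
     distr M (borel_of (skorohod_topology T)) (\<lambda>\<omega>. \<lambda>t\<in>{0..T}. gelfand_dual i (X \<omega> t))"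

end

(* Averaging the Aldous condition over deterministic lags bounds the increments of a scalar process
   between stopping times that are close to each other.  Applied to the successive times at which
   the process, sampled on a grid, has moved by a fixed amount, this bounds first the number of such
   times and then the probability that two of them are close, uniformly in the grid; since the paths
   are continuous, refining the grid gives a uniform bound on the modulus of continuity of the
   process tested against any y.  By compactness of the embedding, finitely many y control the norm
   of the dual space on bounded sets up to a small error, and bounded sets of H are relatively
   compact in that space.  Hence, with probability close to 1, all paths lie in one equicontinuous
   set with values in a compact set. *)

theory Submission
  imports Defs
begin

text \<open>Two mismatches between hypothesis and goal shape the argument. The condition on stopping
  times concerns one fixed sequence at a time, while crossing times vary with the process, the grid
  and the level; choosing a worst sequence makes it uniform over all stopping times. It also
  concerns deterministic lags, while crossings are separated by random ones; comparing both
  crossings with common later times removes the randomness. Sampling on a finite grid makes crossing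
  times finitely valued, so that the stopping property is a finite computation, but then no constant
  may depend on the mesh. For this the bound \<open>q\<close> on the number of crossings is fixed
  from a first lag threshold \<open>d1\<close>, and only afterwards a second threshold
  \<open>d2\<close> is chosen with tolerance proportional to \<open>1 / q\<close>, which pays for a
  union bound over \<open>q\<close> crossings. The laws live on cadlag paths, yet the compact set
  consists of continuous ones; there uniform closeness is enough, by the identity time
  change.\<close>

section \<open>The Skorohod distance as a metric on cadlag paths\<close>

lemma cadlag_locally_bounded:
  fixes \<phi> :: "real \<Rightarrow> 'b::real_normed_vector"
  assumes "\<phi> \<in> cadlag_space T" "t \<in> {0..T}"
  shows "\<exists>d>0. \<exists>B. \<forall>s\<in>{0..T}. \<bar>s - t\<bar> < d \<longrightarrow> norm (\<phi> s) \<le> B"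
proof -
  have right: "\<exists>d>0. \<exists>B. \<forall>s\<in>{0..T}. t < s \<and> s < t + d \<longrightarrow> norm (\<phi> s) \<le> B"
  proof (cases "t < T")
    case True
    then have "(\<phi> \<longlongrightarrow> \<phi> t) (at_right t)"
      using assms by (auto simp: cadlag_space_def)
    then have "\<forall>\<^sub>F s in at_right t. dist (\<phi> s) (\<phi> t) < 1"
      by (rule tendstoD) simp
    then obtain b where b: "b > t" "\<And>s. t < s \<Longrightarrow> s < b \<Longrightarrow> dist (\<phi> s) (\<phi> t) < 1"
      unfolding eventually_at_right_field by blast
    have "norm (\<phi> s) \<le> norm (\<phi> t) + 1" if "t < s" "s < t + (b - t)" for s
      using b(2)[of s] that norm_triangle_ineq2[of "\<phi> s" "\<phi> t"] by (simp add: dist_norm)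
    then show ?thesis using b(1) by (intro exI[of _ "b - t"]) auto
  next
    case False
    then show ?thesis using assms(2) by (intro exI[of _ 1]) auto
  qed
  have left: "\<exists>d>0. \<exists>B. \<forall>s\<in>{0..T}. s < t \<and> t - d < s \<longrightarrow> norm (\<phi> s) \<le> B"
  proof (cases "0 < t")
    case True
    moreover have "\<forall>t\<in>{0<..T}. \<exists>l. (\<phi> \<longlongrightarrow> l) (at_left t)"
      using assms(1) by (simp add: cadlag_space_def)
    ultimately obtain l where "(\<phi> \<longlongrightarrow> l) (at_left t)"
      using assms(2) by fastforce
    then have "\<forall>\<^sub>F s in at_left t. dist (\<phi> s) l < 1"
      by (rule tendstoD) simp
    then obtain b where b: "b < t" "\<And>s. b < s \<Longrightarrow> s < t \<Longrightarrow> dist (\<phi> s) l < 1"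
      unfolding eventually_at_left_field by blast
    have "norm (\<phi> s) \<le> norm l + 1" if "s < t" "t - (t - b) < s" for s
      using b(2)[of s] that norm_triangle_ineq2[of "\<phi> s" l] by (simp add: dist_norm)
    then show ?thesis using b(1) by (intro exI[of _ "t - b"]) auto
  next
    case False
    then show ?thesis using assms(2) by (intro exI[of _ 1]) auto
  qed
  obtain d1 B1 where 1: "d1 > 0" "\<And>s. s\<in>{0..T} \<Longrightarrow> t < s \<Longrightarrow> s < t + d1 \<Longrightarrow> norm (\<phi> s) \<le> B1"
    using right by blast
  obtain d2 B2 where 2: "d2 > 0" "\<And>s. s\<in>{0..T} \<Longrightarrow> s < t \<Longrightarrow> t - d2 < s \<Longrightarrow> norm (\<phi> s) \<le> B2"
    using left by blast
  have "norm (\<phi> s) \<le> max (norm (\<phi> t)) (max B1 B2)" if "s \<in> {0..T}" "\<bar>s - t\<bar> < min d1 d2" for s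
  proof (cases s t rule: linorder_cases)
    case less
    then show ?thesis using 2(2)[of s] that by (auto simp: le_max_iff_disj)
  next
    case equal
    then show ?thesis by simp
  next
    case greater
    then show ?thesis using 1(2)[of s] that by (auto simp: le_max_iff_disj)
  qed
  moreover have "min d1 d2 > 0" using 1(1) 2(1) by simp
  ultimately show ?thesis by blast
qed

text \<open>Compactness of the interval makes the local bounds global. Boundedness is what gives the
  real-valued suprema in \<open>skorohod_dist\<close> their meaning.\<close>

lemma cadlag_bounded:
  fixes \<phi> :: "real \<Rightarrow> 'b::real_normed_vector"
  assumes "\<phi> \<in> cadlag_space T"
  shows "\<exists>B. \<forall>t\<in>{0..T}. norm (\<phi> t) \<le> B"
proof -
  obtain d B where dB: "\<And>t. t \<in> {0..T} \<Longrightarrow> d t > 0"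
    "\<And>t s. t \<in> {0..T} \<Longrightarrow> s\<in>{0..T} \<Longrightarrow> \<bar>s - t\<bar> < d t \<Longrightarrow> norm (\<phi> s) \<le> B t"
    using cadlag_locally_bounded[OF assms] by metis
  obtain C where C: "C \<subseteq> {0..T}" "finite C" "{0..T} \<subseteq> (\<Union>c\<in>C. ball c (d c))"
  proof (rule compactE_image[of "{0..T}" "{0..T}" "\<lambda>t. ball t (d t)"])
    show "{0..T} \<subseteq> (\<Union>t\<in>{0..T}. ball t (d t))" using dB(1) by force
  qed auto
  have "norm (\<phi> t) \<le> (\<Sum>c\<in>C. \<bar>B c\<bar>)" if t: "t \<in> {0..T}" for t
  proof -
    obtain c where c: "c \<in> C" "t \<in> ball c (d c)" using C(3) t by auto
    then have "norm (\<phi> t) \<le> B c"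
      using dB(2)[of c t] t C(1) by (auto simp: dist_real_def abs_minus_commute)
    also have "\<dots> \<le> \<bar>B c\<bar>" by simp
    also have "\<dots> \<le> (\<Sum>c\<in>C. \<bar>B c\<bar>)" using c(1) C(2) by (intro member_le_sum) auto
    finally show ?thesis .
  qed
  then show ?thesis by blast
qed

lemma time_changes_range:
  "\<eta> \<in> time_changes T \<Longrightarrow> t \<in> {0..T} \<Longrightarrow> \<eta> t \<in> {0..T}"
  unfolding time_changes_def by blast

lemma id_time_change: "(\<lambda>t. t) \<in> time_changes T"
  by (auto simp: time_changes_def strict_mono_on_def)

lemma time_change_comp:
  assumes "\<eta> \<in> time_changes T" "\<theta> \<in> time_changes T"
  shows "\<theta> \<circ> \<eta> \<in> time_changes T"
proof -
  have "continuous_on {0..T} (\<theta> \<circ> \<eta>)"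
    using assms by (intro continuous_on_compose) (auto simp: time_changes_def)
  moreover have "strict_mono_on {0..T} (\<theta> \<circ> \<eta>)"
    using assms time_changes_range[OF assms(1)]
    by (auto simp: time_changes_def strict_mono_on_def)
  moreover have "(\<theta> \<circ> \<eta>) ` {0..T} = {0..T}"
    using assms unfolding time_changes_def image_comp[symmetric] by auto
  ultimately show ?thesis by (simp add: time_changes_def)
qed

text \<open>A continuous bijection of a compact interval has a continuous inverse, and the inverse
  of an increasing map is increasing. Symmetry of the Skorohod distance rests on this.\<close>

lemma time_change_inverse:
  assumes "\<eta> \<in> time_changes T"
  obtains \<theta> where "\<theta> \<in> time_changes T" "\<And>t. t \<in> {0..T} \<Longrightarrow> \<theta> (\<eta> t) = t"
    "\<And>t. t \<in> {0..T} \<Longrightarrow> \<eta> (\<theta> t) = t"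
proof -
  have sm: "strict_mono_on {0..T} \<eta>" and co: "continuous_on {0..T} \<eta>"
    and im: "\<eta> ` {0..T} = {0..T}"
    using assms by (auto simp: time_changes_def)
  have inj: "inj_on \<eta> {0..T}" using sm by (rule strict_mono_on_imp_inj_on)
  define \<theta> where "\<theta> = inv_into {0..T} \<eta>"
  have 1: "\<theta> (\<eta> t) = t" if "t \<in> {0..T}" for t
    using that inj by (simp add: \<theta>_def)
  have 2: "\<eta> (\<theta> t) = t" if "t \<in> {0..T}" for t
    using that im by (simp add: \<theta>_def f_inv_into_f)
  have rng: "\<theta> t \<in> {0..T}" if "t \<in> {0..T}" for t
    using that im unfolding \<theta>_def by (metis inv_into_into)
  have "continuous_on (\<eta> ` {0..T}) \<theta>"
    by (rule continuous_on_inv) (use co 1 in auto)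
  moreover have "strict_mono_on {0..T} \<theta>"
  proof (rule strict_mono_onI)
    fix r s assume rs: "r \<in> {0..T}" "s \<in> {0..T}" "r < s"
    show "\<theta> r < \<theta> s"
      using strict_mono_on_less[OF sm rng[OF rs(1)] rng[OF rs(2)]] rs 2 by simp
  qed
  moreover have "\<theta> ` {0..T} = {0..T}"
  proof
    show "\<theta> ` {0..T} \<subseteq> {0..T}" using rng by blast
    show "{0..T} \<subseteq> \<theta> ` {0..T}"
    proof
      fix t assume "t \<in> {0..T}"
      then have "\<eta> t \<in> {0..T}" "t = \<theta> (\<eta> t)" using im 1 by auto
      then show "t \<in> \<theta> ` {0..T}" by blast
    qed
  qed
  ultimately have "\<theta> \<in> time_changes T" using im by (simp add: time_changes_def)
  then show ?thesis using that 1 2 by blast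
qed

text \<open>Right continuity gives no information at \<open>T\<close>. Two paths at distance 0 agree
  there because every time change fixes the endpoint.\<close>

lemma time_change_end:
  assumes "\<eta> \<in> time_changes T" "T \<ge> 0"
  shows "\<eta> T = T"
proof (rule antisym)
  show "\<eta> T \<le> T" using time_changes_range[OF assms(1), of T] assms(2) by simp
  obtain s where s: "s \<in> {0..T}" "\<eta> s = T"
    using assms unfolding time_changes_def by (metis (mono_tags, lifting) atLeastAtMost_iff imageE mem_Collect_eq order_refl)
  have "mono_on {0..T} \<eta>" using assms(1) by (auto simp: time_changes_def strict_mono_on_imp_mono_on)
  then have "\<eta> s \<le> \<eta> T" using s assms(2) by (auto simp: mono_on_def)
  then show "T \<le> \<eta> T" using s by simp
qed

text \<open>A strict bound on the infimum is met by a single time change. The intermediate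
  \<open>r'\<close> is there because strict pointwise bounds would not bound the suprema
  strictly.\<close>

lemma skorohod_dist_less_iff:
  fixes \<phi> \<psi> :: "real \<Rightarrow> 'b::real_normed_vector"
  assumes "\<phi> \<in> cadlag_space T" "\<psi> \<in> cadlag_space T" "T \<ge> 0"
  shows "skorohod_dist T \<phi> \<psi> < r \<longleftrightarrow>
    (\<exists>\<eta>\<in>time_changes T. \<exists>r'<r. \<forall>t\<in>{0..T}. \<bar>\<eta> t - t\<bar> \<le> r' \<and> norm (\<phi> t - \<psi> (\<eta> t)) \<le> r')"
proof -
  obtain B1 B2 where B: "\<And>t. t \<in> {0..T} \<Longrightarrow> norm (\<phi> t) \<le> B1" "\<And>t. t \<in> {0..T} \<Longrightarrow> norm (\<psi> t) \<le> B2"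
    using cadlag_bounded[OF assms(1)] cadlag_bounded[OF assms(2)] by blast
  let ?a = "\<lambda>\<eta>. SUP t\<in>{0..T}. \<bar>\<eta> t - t\<bar>"
  let ?b = "\<lambda>\<eta>. SUP t\<in>{0..T}. norm (\<phi> t - \<psi> (\<eta> t))"
  have ne: "{0..T} \<noteq> {}" using assms(3) by auto
  have bdda: "bdd_above ((\<lambda>t. \<bar>\<eta> t - t\<bar>) ` {0..T})" if "\<eta> \<in> time_changes T" for \<eta>
  proof (rule bdd_aboveI2)
    fix t assume "t \<in> {0..T}"
    then show "\<bar>\<eta> t - t\<bar> \<le> T" using time_changes_range[OF that, of t] by auto
  qed
  have bddb: "bdd_above ((\<lambda>t. norm (\<phi> t - \<psi> (\<eta> t))) ` {0..T})" if "\<eta> \<in> time_changes T" for \<eta>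
  proof (rule bdd_aboveI2)
    fix t assume "t \<in> {0..T}"
    then show "norm (\<phi> t - \<psi> (\<eta> t)) \<le> B1 + B2"
      using B(1)[of t] B(2)[of "\<eta> t"] time_changes_range[OF that, of t]
        norm_triangle_ineq4[of "\<phi> t" "\<psi> (\<eta> t)"] by linarith
  qed
  have le: "max (?a \<eta>) (?b \<eta>) \<le> r' \<longleftrightarrow> (\<forall>t\<in>{0..T}. \<bar>\<eta> t - t\<bar> \<le> r' \<and> norm (\<phi> t - \<psi> (\<eta> t)) \<le> r')"
    if "\<eta> \<in> time_changes T" for \<eta> r'
    using cSUP_le_iff[OF ne bdda[OF that], of r'] cSUP_le_iff[OF ne bddb[OF that], of r'] by auto
  have bb: "bdd_below ((\<lambda>\<eta>. max (?a \<eta>) (?b \<eta>)) ` time_changes T)"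
  proof (rule bdd_belowI2)
    fix \<eta> assume "\<eta> \<in> time_changes T"
    then have "\<bar>\<eta> 0 - 0\<bar> \<le> ?a \<eta>" using assms(3) by (intro cSUP_upper bdda) auto
    then show "0 \<le> max (?a \<eta>) (?b \<eta>)" by linarith
  qed
  have "skorohod_dist T \<phi> \<psi> < r \<longleftrightarrow> (\<exists>\<eta>\<in>time_changes T. max (?a \<eta>) (?b \<eta>) < r)"
    unfolding skorohod_dist_def using id_time_change[of T] by (intro cINF_less_iff bb) auto
  also have "\<dots> \<longleftrightarrow> (\<exists>\<eta>\<in>time_changes T. \<exists>r'<r. max (?a \<eta>) (?b \<eta>) \<le> r')"
    by (meson order_le_less_trans order_refl)
  finally show ?thesis using le by (simp cong: bex_cong)
qed

text \<open>The topology generated by \<open>skorohod_dist\<close> is the intended one only once the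
  metric axioms hold. The locale asks for nonnegativity and symmetry on all functions, so these two
  are derived without boundedness of the paths.\<close>

lemma Metric_space_skorohod:
  assumes "T \<ge> 0"
  shows "Metric_space (cadlag_space T :: (real \<Rightarrow> 'b::real_normed_vector) set) (skorohod_dist T)"
proof -
  define D where "D = (\<lambda>(\<phi> :: real \<Rightarrow> 'b) \<psi> \<eta>.
    max (SUP t\<in>{0..T}. \<bar>\<eta> t - t\<bar>) (SUP t\<in>{0..T}. norm (\<phi> t - \<psi> (\<eta> t))))"
  have dist_eq: "skorohod_dist T \<phi> \<psi> = Inf (D \<phi> \<psi> ` time_changes T)" for \<phi> \<psi> :: "real \<Rightarrow> 'b"
    by (simp add: skorohod_dist_def D_def)
  have nonneg: "0 \<le> skorohod_dist T \<phi> \<psi>" for \<phi> \<psi> :: "real \<Rightarrow> 'b"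
    unfolding dist_eq
  proof (rule cINF_greatest)
    show "time_changes T \<noteq> {}" using id_time_change by blast
    fix \<eta> assume "\<eta> \<in> time_changes T"
    then have "bdd_above ((\<lambda>t. \<bar>\<eta> t - t\<bar>) ` {0..T})"
      using time_changes_range by (intro bdd_aboveI2[of _ _ T]) fastforce
    then have "\<bar>\<eta> 0 - 0\<bar> \<le> (SUP t\<in>{0..T}. \<bar>\<eta> t - t\<bar>)"
      using assms by (intro cSUP_upper) auto
    then show "0 \<le> D \<phi> \<psi> \<eta>" unfolding D_def by linarith
  qed
  have sub: "D \<phi> \<psi> ` time_changes T \<subseteq> D \<psi> \<phi> ` time_changes T" for \<phi> \<psi> :: "real \<Rightarrow> 'b"
  proof
    fix x assume "x \<in> D \<phi> \<psi> ` time_changes T"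
    then obtain \<eta> where \<eta>: "\<eta> \<in> time_changes T" "x = D \<phi> \<psi> \<eta>" by blast
    obtain \<theta> where \<theta>: "\<theta> \<in> time_changes T" "\<And>t. t \<in> {0..T} \<Longrightarrow> \<theta> (\<eta> t) = t"
      using time_change_inverse[OF \<eta>(1)] by metis
    have im: "{0..T} = \<eta> ` {0..T}" using \<eta>(1) by (simp add: time_changes_def)
    \<comment> \<open>Both suprema range over the same set of values, since \<open>\<eta>\<close>
      maps the interval onto itself; hence this holds for unbounded \<open>f\<close> too.\<close>
    have re: "(SUP t\<in>{0..T}. f t) = (SUP t\<in>{0..T}. f (\<eta> t))" for f :: "real \<Rightarrow> real"
      by (subst im) (simp add: image_image)
    have "D \<psi> \<phi> \<theta> = D \<phi> \<psi> \<eta>"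
      unfolding D_def re[of "\<lambda>t. \<bar>\<theta> t - t\<bar>"] re[of "\<lambda>t. norm (\<psi> t - \<phi> (\<theta> t))"]
      using \<theta>(2) by (simp add: abs_minus_commute norm_minus_commute cong: image_cong_simp)
    then show "x \<in> D \<psi> \<phi> ` time_changes T" using \<eta>(2) \<theta>(1) by (metis imageI)
  qed
  have comm: "skorohod_dist T \<phi> \<psi> = skorohod_dist T \<psi> \<phi>" for \<phi> \<psi> :: "real \<Rightarrow> 'b"
    unfolding dist_eq using sub by (metis subset_antisym)
  have tri: "skorohod_dist T \<phi> \<zeta> \<le> skorohod_dist T \<phi> \<psi> + skorohod_dist T \<psi> \<zeta>"
    if c: "\<phi> \<in> cadlag_space T" "\<psi> \<in> cadlag_space T" "\<zeta> \<in> cadlag_space T" for \<phi> \<psi> \<zeta> :: "real \<Rightarrow> 'b"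
  proof (rule field_le_epsilon)
    fix e :: real assume e: "e > 0"
    obtain \<eta> r1 where \<eta>: "\<eta> \<in> time_changes T" "r1 < skorohod_dist T \<phi> \<psi> + e/2"
      "\<And>t. t\<in>{0..T} \<Longrightarrow> \<bar>\<eta> t - t\<bar> \<le> r1 \<and> norm (\<phi> t - \<psi> (\<eta> t)) \<le> r1"
      using skorohod_dist_less_iff[OF c(1,2) assms, of "skorohod_dist T \<phi> \<psi> + e/2"] e by auto
    obtain \<theta> r2 where \<theta>: "\<theta> \<in> time_changes T" "r2 < skorohod_dist T \<psi> \<zeta> + e/2"
      "\<And>t. t\<in>{0..T} \<Longrightarrow> \<bar>\<theta> t - t\<bar> \<le> r2 \<and> norm (\<psi> t - \<zeta> (\<theta> t)) \<le> r2"
      using skorohod_dist_less_iff[OF c(2,3) assms, of "skorohod_dist T \<psi> \<zeta> + e/2"] e by auto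
    have "\<forall>t\<in>{0..T}. \<bar>(\<theta> \<circ> \<eta>) t - t\<bar> \<le> r1 + r2 \<and> norm (\<phi> t - \<zeta> ((\<theta> \<circ> \<eta>) t)) \<le> r1 + r2"
    proof
      fix t assume t: "t \<in> {0..T}"
      note * = \<eta>(3)[OF t] \<theta>(3)[OF time_changes_range[OF \<eta>(1) t]]
      have "norm (\<phi> t - \<zeta> (\<theta> (\<eta> t))) \<le> r1 + r2"
        using norm_diff_triangle_le[of "\<phi> t" "\<psi> (\<eta> t)" r1 "\<zeta> (\<theta> (\<eta> t))" r2] * by blast
      then show "\<bar>(\<theta> \<circ> \<eta>) t - t\<bar> \<le> r1 + r2 \<and> norm (\<phi> t - \<zeta> ((\<theta> \<circ> \<eta>) t)) \<le> r1 + r2"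
        using * by auto
    qed
    moreover have "r1 + r2 < skorohod_dist T \<phi> \<psi> + skorohod_dist T \<psi> \<zeta> + e" using \<eta>(2) \<theta>(2) by linarith
    ultimately have "skorohod_dist T \<phi> \<zeta> < skorohod_dist T \<phi> \<psi> + skorohod_dist T \<psi> \<zeta> + e"
      using skorohod_dist_less_iff[OF c(1,3) assms] time_change_comp[OF \<eta>(1) \<theta>(1)] by blast
    then show "skorohod_dist T \<phi> \<zeta> \<le> skorohod_dist T \<phi> \<psi> + skorohod_dist T \<psi> \<zeta> + e" by simp
  qed
  have self: "skorohod_dist T \<phi> \<phi> = 0" if "\<phi> \<in> cadlag_space T" for \<phi> :: "real \<Rightarrow> 'b"
  proof (rule antisym)
    show "skorohod_dist T \<phi> \<phi> \<le> 0"
    proof (rule dense_ge)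
      fix r :: real assume "0 < r"
      then have "skorohod_dist T \<phi> \<phi> < r"
        using id_time_change[of T] by (subst skorohod_dist_less_iff[OF that that assms]) (auto intro!: bexI[OF _ id_time_change] exI[of _ 0])
      then show "skorohod_dist T \<phi> \<phi> \<le> r" by simp
    qed
  qed (rule nonneg)
  have eq: "\<phi> = \<psi>" if d0: "skorohod_dist T \<phi> \<psi> = 0"
    and c: "\<phi> \<in> cadlag_space T" "\<psi> \<in> cadlag_space T" for \<phi> \<psi> :: "real \<Rightarrow> 'b"
  proof (rule extensionalityI[of _ "{0..T}"])
    show "\<phi> \<in> extensional {0..T}" "\<psi> \<in> extensional {0..T}" using c by (auto simp: cadlag_space_def)
    fix t assume t: "t \<in> {0..T}"
    have "norm (\<phi> t - \<psi> t) \<le> 0 + e" if e: "e > 0" for e :: real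
    proof (cases "t < T")
      case True
      have ev: "\<forall>\<^sub>F s in at_right t. dist (\<phi> s) (\<phi> t) < e/3" "\<forall>\<^sub>F s in at_right t. dist (\<psi> s) (\<psi> t) < e/3"
        by (rule tendstoD[of _ _ _ "e/3"]; use c True t e in \<open>simp add: cadlag_space_def\<close>)+
      obtain b1 b2 where b: "b1 > t" "\<And>s. t < s \<Longrightarrow> s < b1 \<Longrightarrow> dist (\<phi> s) (\<phi> t) < e/3"
        "b2 > t" "\<And>s. t < s \<Longrightarrow> s < b2 \<Longrightarrow> dist (\<psi> s) (\<psi> t) < e/3"
        using ev unfolding eventually_at_right_field by blast
      \<comment> \<open>A time change may move \<open>t\<close> to its left, where the path can
        jump. The comparison is therefore made at \<open>t + d/2\<close> with a shift below
        \<open>d/2\<close>, so that this point and its image both lie to the right of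
        \<open>t\<close>, within reach of right continuity.\<close>
      define d where "d = min T (min b1 b2) - t"
      have d: "d > 0" "t + d \<le> T" "t + d \<le> b1" "t + d \<le> b2" using True b by (auto simp: d_def)
      obtain \<eta> r' where \<eta>: "\<eta> \<in> time_changes T" "r' < min (d/2) (e/3)"
        "\<And>t. t\<in>{0..T} \<Longrightarrow> \<bar>\<eta> t - t\<bar> \<le> r' \<and> norm (\<phi> t - \<psi> (\<eta> t)) \<le> r'"
        using skorohod_dist_less_iff[OF c assms, of "min (d/2) (e/3)"] d0 e d(1) by auto
      have s: "t + d/2 \<in> {0..T}" using d t by auto
      have "\<bar>\<eta> (t + d/2) - (t + d/2)\<bar> < d/2" using \<eta>(3)[OF s] \<eta>(2) by linarith
      then have "t < \<eta> (t + d/2)" "\<eta> (t + d/2) < t + d" by (auto simp: abs_less_iff field_simps)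
      then have "dist (\<psi> (\<eta> (t + d/2))) (\<psi> t) < e/3" "dist (\<phi> (t + d/2)) (\<phi> t) < e/3"
        using b d by auto
      moreover have "dist (\<phi> (t + d/2)) (\<psi> (\<eta> (t + d/2))) < e/3"
        using \<eta>(2,3) s unfolding dist_norm by fastforce
      ultimately have "dist (\<phi> t) (\<psi> t) < e"
        using dist_triangle[of "\<phi> t" "\<psi> t" "\<phi> (t + d/2)"]
          dist_triangle[of "\<phi> (t + d/2)" "\<psi> t" "\<psi> (\<eta> (t + d/2))"] by (simp add: dist_commute)
      then show ?thesis by (simp add: dist_norm)
    next
      case False
      then have tT: "t = T" using t by auto
      obtain \<eta> r' where \<eta>: "\<eta> \<in> time_changes T" "r' < e"
        "\<And>t. t\<in>{0..T} \<Longrightarrow> \<bar>\<eta> t - t\<bar> \<le> r' \<and> norm (\<phi> t - \<psi> (\<eta> t)) \<le> r'"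
        using skorohod_dist_less_iff[OF c assms, of e] d0 e by auto
      then show ?thesis using \<eta>(3)[OF t] time_change_end[OF \<eta>(1) assms] tT by auto
    qed
    then have "norm (\<phi> t - \<psi> t) \<le> 0" by (rule field_le_epsilon)
    then show "\<phi> t = \<psi> t" by simp
  qed
  show ?thesis
  proof
    fix \<phi> \<psi> \<zeta> :: "real \<Rightarrow> 'b"
    show "0 \<le> skorohod_dist T \<phi> \<psi>" by (rule nonneg)
    show "skorohod_dist T \<phi> \<psi> = skorohod_dist T \<psi> \<phi>" by (rule comm)
    show "(skorohod_dist T \<phi> \<psi> = 0) = (\<phi> = \<psi>)"
      if "\<phi> \<in> cadlag_space T" "\<psi> \<in> cadlag_space T" using self eq that by blast
    show "skorohod_dist T \<phi> \<zeta> \<le> skorohod_dist T \<phi> \<psi> + skorohod_dist T \<psi> \<zeta>"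
      if "\<phi> \<in> cadlag_space T" "\<psi> \<in> cadlag_space T" "\<zeta> \<in> cadlag_space T"
      using tri that by blast
  qed
qed

lemma openin_skorohod_iff:
  fixes U :: "(real \<Rightarrow> 'b::real_normed_vector) set"
  assumes "T \<ge> 0"
  shows "openin (skorohod_topology T) U \<longleftrightarrow> U \<subseteq> cadlag_space T \<and>
    (\<forall>\<phi>\<in>U. \<exists>r>0. \<forall>\<psi>\<in>cadlag_space T. skorohod_dist T \<phi> \<psi> < r \<longrightarrow> \<psi> \<in> U)"
proof -
  interpret Metric_space "cadlag_space T :: (real \<Rightarrow> 'b) set" "skorohod_dist T"
    using assms by (rule Metric_space_skorohod)
  show ?thesis
    unfolding skorohod_topology_def openin_mtopology subset_iff in_mball by blast
qed

lemma topspace_skorohod: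
  "T \<ge> 0 \<Longrightarrow> topspace (skorohod_topology T) = (cadlag_space T :: (real \<Rightarrow> 'b::real_normed_vector) set)"
  unfolding skorohod_topology_def
  by (intro Metric_space.topspace_mtopology Metric_space_skorohod)

lemma Hausdorff_skorohod:
  "T \<ge> 0 \<Longrightarrow> Hausdorff_space (skorohod_topology T :: (real \<Rightarrow> 'b::real_normed_vector) topology)"
  unfolding skorohod_topology_def
  by (intro Metric_space.Hausdorff_space_mtopology Metric_space_skorohod)

section \<open>Compact sets of equicontinuous paths\<close>

lemma continuous_in_cadlag_space:
  fixes f :: "real \<Rightarrow> 'b::topological_space"
  assumes "continuous_on {0..T} f" "f \<in> extensional {0..T}"
  shows "f \<in> cadlag_space T"
proof -
  have "(f \<longlongrightarrow> f t) (at_right t)" if t: "t \<in> {0..<T}" for t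
  proof -
    have "continuous_on {t..T} f" using assms(1) t by (elim continuous_on_subset) auto
    then have "(f \<longlongrightarrow> f t) (at t within {t..T})" using t by (auto simp: continuous_on_def)
    then show ?thesis using t by (simp add: at_within_Icc_at_right)
  qed
  moreover have "(f \<longlongrightarrow> f t) (at_left t)" if t: "t \<in> {0<..T}" for t
  proof -
    have "continuous_on {0..t} f" using assms(1) t by (elim continuous_on_subset) auto
    then have "(f \<longlongrightarrow> f t) (at t within {0..t})" using t by (auto simp: continuous_on_def)
    then show ?thesis using t by (simp add: at_within_Icc_at_left)
  qed
  ultimately show ?thesis using assms(2) unfolding cadlag_space_def by blast
qed

lemma skorohod_dist_le_uniform:
  fixes \<phi> \<psi> :: "real \<Rightarrow> 'b::real_normed_vector"
  assumes "\<phi> \<in> cadlag_space T" "\<psi> \<in> cadlag_space T" "T \<ge> 0"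
    and "\<And>t. t \<in> {0..T} \<Longrightarrow> norm (\<phi> t - \<psi> t) \<le> r"
  shows "skorohod_dist T \<phi> \<psi> \<le> r"
proof (rule dense_ge)
  fix s assume "r < s"
  moreover have "0 \<le> r" using order_trans[OF norm_ge_zero assms(4)[of 0]] assms(3) by simp
  ultimately have "skorohod_dist T \<phi> \<psi> < s"
    unfolding skorohod_dist_less_iff[OF assms(1-3)]
    using assms(4) by (intro bexI[OF _ id_time_change] exI[of _ r]) auto
  then show "skorohod_dist T \<phi> \<psi> \<le> s" by simp
qed

text \<open>The sequences \<open>\<delta>\<close> and \<open>w\<close> prescribe one common modulus
  of continuity; continuity of the members follows once \<open>w\<close> tends to 0. The weak
  inequality keeps the condition closed under pointwise limits.\<close>

definition equicontinuous_paths ::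
    "real \<Rightarrow> 'b::real_normed_vector set \<Rightarrow> (nat \<Rightarrow> real) \<Rightarrow> (nat \<Rightarrow> real) \<Rightarrow> (real \<Rightarrow> 'b) set" where
  "equicontinuous_paths T A \<delta> w =
     {\<phi> \<in> extensional {0..T}. (\<forall>t\<in>{0..T}. \<phi> t \<in> A) \<and>
        (\<forall>m. \<forall>s\<in>{0..T}. \<forall>t\<in>{0..T}. \<bar>s - t\<bar> < \<delta> m \<longrightarrow> norm (\<phi> s - \<phi> t) \<le> w m)}"

lemma equicontinuous_paths_cadlag:
  assumes "\<And>m. \<delta> m > 0" "w \<longlonglongrightarrow> 0"
  shows "equicontinuous_paths T A \<delta> w \<subseteq> cadlag_space T"
proof
  fix \<phi> assume \<phi>: "\<phi> \<in> equicontinuous_paths T A \<delta> w"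
  have "continuous_on {0..T} \<phi>"
    unfolding continuous_on_iff
  proof (intro ballI allI impI)
    fix t e :: real assume t: "t \<in> {0..T}" and e: "0 < e"
    obtain m where "w m < e"
      using order_tendstoD(2)[OF assms(2) e] by (auto simp: eventually_sequentially)
    then show "\<exists>d>0. \<forall>s\<in>{0..T}. dist s t < d \<longrightarrow> dist (\<phi> s) (\<phi> t) < e"
      using \<phi> t assms(1)[of m]
      by (intro exI[of _ "\<delta> m"]) (fastforce simp: equicontinuous_paths_def dist_norm)
  qed
  then show "\<phi> \<in> cadlag_space T"
    using \<phi> by (intro continuous_in_cadlag_space) (auto simp: equicontinuous_paths_def)
qed

text \<open>On an equicontinuous set the topology of pointwise convergence refines the Skorohod
  topology, so Tychonoff's theorem gives compactness.\<close>

lemma compactin_equicontinuous_paths: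
  fixes A :: "'b::real_normed_vector set"
  assumes T: "T \<ge> 0" and A: "compact A" and \<delta>: "\<And>m. \<delta> m > 0" and w: "w \<longlonglongrightarrow> 0"
  shows "compactin (skorohod_topology T) (equicontinuous_paths T A \<delta> w)"
proof -
  define E where "E = equicontinuous_paths T A \<delta> w"
  define P :: "(real \<Rightarrow> 'b) topology" where "P = product_topology (\<lambda>_. euclidean) {0..T}"
  have topP: "topspace P = extensional {0..T}" by (simp add: P_def PiE_def)
  have Ecad: "E \<subseteq> cadlag_space T"
    unfolding E_def by (rule equicontinuous_paths_cadlag[OF \<delta> w])
  have "closedin P {\<phi> \<in> topspace P. norm (\<phi> s - \<phi> t) \<in> {..w m}}"
    if "s \<in> {0..T}" "t \<in> {0..T}" for s t m
    unfolding P_def using that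
    by (intro closedin_continuous_map_preimage[of _ euclideanreal] continuous_map_norm
        continuous_map_diff continuous_map_product_projection) auto
  \<comment> \<open>An intersection of closed sets is closed here only for a nonempty family; the
    index triple with all entries 0 provides a member.\<close>
  then have "closedin P (\<Inter> ((\<lambda>(m,s,t). {\<phi> \<in> topspace P. norm (\<phi> s - \<phi> t) \<in> {..w m}}) `
      {(m,s,t). s \<in> {0..T} \<and> t \<in> {0..T} \<and> \<bar>s - t\<bar> < \<delta> m}))" (is "closedin P ?C")
    using T \<delta>[of 0] by (intro closedin_Inter) (auto intro!: exI[of _ 0])
  moreover have "compactin P (PiE {0..T} (\<lambda>_. A))"
    using A by (simp add: P_def compactin_PiE)
  ultimately have "compactin P (?C \<inter> PiE {0..T} (\<lambda>_. A))" by (rule closed_Int_compactin)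
  moreover have "?C \<inter> PiE {0..T} (\<lambda>_. A) = E"
    unfolding E_def equicontinuous_paths_def topP by (auto simp: PiE_def Pi_def)
  ultimately have cP: "compactin (subtopology P E) E"
    by (simp add: compactin_subtopology)
  have "continuous_map (subtopology P E) (skorohod_topology T) (\<lambda>\<phi>. \<phi>)"
    unfolding continuous_map_def
  proof (intro conjI allI impI)
    show "(\<lambda>\<phi>. \<phi>) \<in> topspace (subtopology P E) \<rightarrow> topspace (skorohod_topology T)"
      using Ecad by (auto simp: topspace_skorohod[OF T])
    fix U :: "(real \<Rightarrow> 'b) set" assume U: "openin (skorohod_topology T) U"
    have "\<exists>V. openin (subtopology P E) V \<and> \<phi> \<in> V \<and> V \<subseteq> {x \<in> topspace (subtopology P E). x \<in> U}"
      if "\<phi> \<in> {x \<in> topspace (subtopology P E). x \<in> U}" for \<phi>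
    proof -
      have \<phi>: "\<phi> \<in> E" "\<phi> \<in> U" "\<phi> \<in> extensional {0..T}" using that topP by auto
      obtain r where r: "r > 0" "\<And>\<psi>. \<psi> \<in> cadlag_space T \<Longrightarrow> skorohod_dist T \<phi> \<psi> < r \<Longrightarrow> \<psi> \<in> U"
        using U \<phi>(2) unfolding openin_skorohod_iff[OF T] by meson
      obtain m where m: "w m < r/4"
        using order_tendstoD(2)[OF w, of "r/4"] r(1) by (auto simp: eventually_sequentially)
      obtain G where G: "G \<subseteq> {0..T}" "finite G" "{0..T} \<subseteq> (\<Union>c\<in>G. ball c (\<delta> m))"
      proof (rule compactE_image[of "{0..T}" "{0..T}" "\<lambda>t. ball t (\<delta> m)"])
        show "{0..T} \<subseteq> (\<Union>t\<in>{0..T}. ball t (\<delta> m))" using \<delta>[of m] by force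
      qed auto
      \<comment> \<open>A basic neighbourhood in the product topology restricts only the finitely
        many net points in \<open>G\<close>. From a net point to \<open>t\<close> each path moves by
        at most \<open>w m\<close>, so the distance at \<open>t\<close> is below
        \<open>r/4 + r/4 + r/4\<close>.\<close>
      define W where "W = PiE {0..T} (\<lambda>c. if c \<in> G then ball (\<phi> c) (r/4) else UNIV)"
      have "finite {c \<in> {0..T}. (if c \<in> G then ball (\<phi> c) (r/4) else UNIV) \<noteq> topspace euclidean}"
        by (rule finite_subset[OF _ G(2)]) auto
      then have W: "openin P W"
        unfolding P_def W_def by (subst openin_PiE_gen) auto
      have "\<psi> \<in> U" if \<psi>: "\<psi> \<in> E" "\<psi> \<in> W" for \<psi>
      proof (rule r(2))
        show \<psi>c: "\<psi> \<in> cadlag_space T" using \<psi>(1) Ecad by blast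
        have "norm (\<phi> t - \<psi> t) \<le> 3/4 * r" if t: "t \<in> {0..T}" for t
        proof -
          obtain c where c: "c \<in> G" "\<bar>t - c\<bar> < \<delta> m" using G(3) t by (force simp: dist_real_def)
          then have cT: "c \<in> {0..T}" using G(1) by blast
          have "norm (\<phi> t - \<phi> c) \<le> w m" "norm (\<psi> c - \<psi> t) \<le> w m"
            using \<phi>(1) \<psi>(1) t cT c(2) unfolding E_def equicontinuous_paths_def
            by (simp_all add: abs_minus_commute)
          moreover have "norm (\<phi> c - \<psi> c) < r/4"
            using PiE_mem[OF \<psi>(2)[unfolded W_def] cT] c(1) by (simp add: dist_norm)
          ultimately show ?thesis
            using norm_triangle_ineq[of "\<phi> t - \<phi> c" "\<phi> c - \<psi> c"]
              norm_triangle_ineq[of "\<phi> t - \<psi> c" "\<psi> c - \<psi> t"] m by simp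
        qed
        then have "skorohod_dist T \<phi> \<psi> \<le> 3/4 * r"
          using \<phi>(1) Ecad \<psi>c T by (intro skorohod_dist_le_uniform) auto
        then show "skorohod_dist T \<phi> \<psi> < r" using r(1) by simp
      qed
      then have "W \<inter> E \<subseteq> {x \<in> topspace (subtopology P E). x \<in> U}"
        using openin_subset[OF W] by auto
      moreover have "openin (subtopology P E) (W \<inter> E)" using W by (auto simp: openin_subtopology)
      moreover have "\<phi> \<in> W \<inter> E" using \<phi> r(1) by (auto simp: W_def PiE_def)
      ultimately show ?thesis by blast
    qed
    then show "openin (subtopology P E) {x \<in> topspace (subtopology P E). x \<in> U}"
      by (subst openin_subopen) blast
  qed
  from image_compactin[OF cP this] show ?thesis by (simp add: E_def)
qed

section \<open>Compactness of the map from H into the dual of Y\<close>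

lemma gelfand_dual_apply [simp]: "blinfun_apply (gelfand_dual i h) y = h \<bullet> blinfun_apply i y"
  by (simp add: gelfand_dual_def)

lemma gelfand_dual_diff: "gelfand_dual i (h - k) = gelfand_dual i h - gelfand_dual i k"
  by (rule blinfun_eqI) (simp add: blinfun.diff_left inner_diff_left)

lemma norm_gelfand_dual_le: "norm (gelfand_dual i h) \<le> norm i * norm h"
proof (rule norm_blinfun_bound)
  fix y
  have "\<bar>h \<bullet> i y\<bar> \<le> norm h * norm (i y)" by (rule Cauchy_Schwarz_ineq2)
  also have "\<dots> \<le> norm h * (norm i * norm y)" by (intro mult_left_mono norm_blinfun) auto
  finally show "norm (blinfun_apply (gelfand_dual i h) y) \<le> norm i * norm h * norm y" by (simp add: mult_ac)
qed simp

text \<open>The image of the unit ball of Y has a finite \<open>e\<close>-net, and \<open>Y\<close>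
  consists of preimages of its points. Replacing a point of the image by a net point changes the
  pairing with \<open>h\<close> by at most \<open>e * norm h\<close>, by Cauchy-Schwarz.\<close>

lemma gelfand_dual_norm_finite_test:
  fixes i :: "'y::real_normed_vector \<Rightarrow>\<^sub>L 'h::real_inner"
  assumes "compact_embedding i" "e > 0"
  obtains Y where "finite Y"
    "\<And>h a. (\<And>y. y \<in> Y \<Longrightarrow> \<bar>h \<bullet> blinfun_apply i y\<bar> \<le> a) \<Longrightarrow> a \<ge> 0 \<Longrightarrow>
       norm (gelfand_dual i h) \<le> a + e * norm h"
proof -
  let ?B = "blinfun_apply i ` cball 0 1"
  have "compact (closure ?B)" using assms(1) unfolding compact_embedding_def by (metis bounded_cball)
  moreover have "closure ?B \<subseteq> (\<Union>b\<in>?B. ball b e)"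
  proof
    fix x assume "x \<in> closure ?B"
    then obtain b where "b \<in> ?B" "dist b x < e" using assms(2) unfolding closure_approachable by blast
    then show "x \<in> (\<Union>b\<in>?B. ball b e)" by (auto simp: dist_commute)
  qed
  ultimately obtain C where C: "C \<subseteq> ?B" "finite C" "closure ?B \<subseteq> (\<Union>b\<in>C. ball b e)"
    using compactE_image[of "closure ?B" ?B "\<lambda>b. ball b e"] open_ball by metis
  obtain Y where Y: "finite Y" "C = blinfun_apply i ` Y"
    using finite_subset_image[OF C(2,1)] by blast
  have "norm (gelfand_dual i h) \<le> a + e * norm h"
    if h: "\<And>y. y \<in> Y \<Longrightarrow> \<bar>h \<bullet> i y\<bar> \<le> a" and a: "a \<ge> 0" for h a
  proof (rule norm_blinfun_bound)
    show "0 \<le> a + e * norm h" using a assms(2) by simp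
    fix y
    have unit: "\<bar>h \<bullet> i z\<bar> \<le> a + e * norm h" if "norm z \<le> 1" for z
    proof -
      have "i z \<in> closure ?B" using that by (intro subsetD[OF closure_subset]) auto
      then obtain y where y: "y \<in> Y" "norm (i z - i y) < e"
        using C(3) Y(2) by (force simp: dist_norm norm_minus_commute)
      have "\<bar>h \<bullet> i z\<bar> \<le> \<bar>h \<bullet> i y\<bar> + \<bar>h \<bullet> (i z - i y)\<bar>" by (simp add: inner_diff_right)
      also have "\<bar>h \<bullet> (i z - i y)\<bar> \<le> norm h * norm (i z - i y)" by (rule Cauchy_Schwarz_ineq2)
      also have "\<dots> \<le> norm h * e" using y(2) by (intro mult_left_mono) auto
      finally show ?thesis using h[OF y(1)] by (simp add: mult.commute)
    qed
    show "norm (blinfun_apply (gelfand_dual i h) y) \<le> (a + e * norm h) * norm y"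
    proof (cases "y = 0")
      case False
      have "\<bar>h \<bullet> i ((1 / norm y) *\<^sub>R y)\<bar> \<le> a + e * norm h" by (rule unit) simp
      then show ?thesis using False by (simp add: blinfun.scaleR_right divide_simps abs_mult)
    qed simp
  qed
  then show ?thesis using that Y(1) by blast
qed

text \<open>The function \<open>f\<close> sorts \<open>S\<close> into finitely many classes on each
  of which \<open>g\<close> varies by less than \<open>e\<close>; one representative per class gives
  the net.\<close>

lemma finite_net_image:
  assumes "finite (f ` S)" "\<And>x y. x \<in> S \<Longrightarrow> y \<in> S \<Longrightarrow> f x = f y \<Longrightarrow> dist (g x) (g y) < e"
  obtains k where "finite k" "g ` S \<subseteq> (\<Union>c\<in>k. ball c e)"
proof
  let ?r = "inv_into S f"
  show "finite (g ` ?r ` f ` S)" using assms(1) by blast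
  show "g ` S \<subseteq> (\<Union>c\<in>g ` ?r ` f ` S. ball c e)"
  proof
    fix z assume "z \<in> g ` S"
    then obtain x where x: "x \<in> S" "z = g x" by blast
    then have "?r (f x) \<in> S" "f (?r (f x)) = f x" by (simp_all add: inv_into_into f_inv_into_f)
    then have "dist (g (?r (f x))) z < e" using assms(2) x by blast
    then show "z \<in> (\<Union>c\<in>g ` ?r ` f ` S. ball c e)" using x(1) by auto
  qed
qed

text \<open>An instance of Schauder's theorem, as \<open>gelfand_dual i\<close> is the adjoint of
  \<open>i\<close> under the Riesz identification. The function \<open>f\<close> records the rounded
  pairings with the finite test set; on a ball there are finitely many records, and equal records
  force closeness in the dual norm.\<close>

lemma compact_closure_gelfand_dual_cball:
  fixes i :: "'y::real_normed_vector \<Rightarrow>\<^sub>L 'h::real_inner"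
  assumes "compact_embedding i"
  shows "compact (closure (gelfand_dual i ` cball 0 R))"
  unfolding compact_eq_totally_bounded
proof (intro conjI allI impI)
  show "uniform_space_class.complete (closure (gelfand_dual i ` cball 0 R))" by (simp add: complete_eq_closed)
  fix e :: real assume e: "e > 0"
  \<comment> \<open>Chosen so that differences of norm at most \<open>2 * \<bar>R\<bar>\<close>
    contribute at most \<open>e/4\<close>; the summand 1 avoids division by zero.\<close>
  define e1 where "e1 = e / 8 / (1 + \<bar>R\<bar>)"
  have e1: "e1 > 0" "e1 * (2 * \<bar>R\<bar>) \<le> e/4" using e by (auto simp: e1_def divide_simps)
  obtain Y where Y: "finite Y" "\<And>h a. (\<And>y. y \<in> Y \<Longrightarrow> \<bar>h \<bullet> blinfun_apply i y\<bar> \<le> a) \<Longrightarrow> a \<ge> 0 \<Longrightarrow>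
       norm (gelfand_dual i h) \<le> a + e1 * norm h"
    using gelfand_dual_norm_finite_test[OF assms e1(1)] by blast
  define a where "a = e/8"
  have a: "a > 0" using e by (simp add: a_def)
  define f where "f = (\<lambda>h. \<lambda>y\<in>Y. \<lfloor>(h \<bullet> blinfun_apply i y) / a\<rfloor>)"
  have "f ` cball 0 R \<subseteq> PiE Y (\<lambda>y. {\<lfloor>-(R * norm (blinfun_apply i y) / a)\<rfloor>..\<lfloor>R * norm (blinfun_apply i y) / a\<rfloor>})"
  proof (clarsimp simp: f_def)
    fix h :: 'h and y assume h: "norm h \<le> R" and "y \<in> Y"
    have "\<bar>h \<bullet> blinfun_apply i y\<bar> \<le> R * norm (blinfun_apply i y)"
      using Cauchy_Schwarz_ineq2[of h "blinfun_apply i y"] mult_right_mono[OF h norm_ge_zero[of "blinfun_apply i y"]] by linarith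
    then have "h \<bullet> blinfun_apply i y / a \<le> R * norm (blinfun_apply i y) / a" "- (R * norm (blinfun_apply i y) / a) \<le> h \<bullet> blinfun_apply i y / a"
      using a by (auto simp: divide_simps)
    then show "\<lfloor>- (R * norm (blinfun_apply i y) / a)\<rfloor> \<le> \<lfloor>h \<bullet> blinfun_apply i y / a\<rfloor> \<and> \<lfloor>h \<bullet> blinfun_apply i y / a\<rfloor> \<le> \<lfloor>R * norm (blinfun_apply i y) / a\<rfloor>"
      by (auto intro: floor_mono)
  qed
  then have fin: "finite (f ` cball 0 R)" by (rule finite_subset) (auto intro!: finite_PiE Y(1))
  have close: "dist (gelfand_dual i h) (gelfand_dual i k) < e/2"
    if "h \<in> cball 0 R" "k \<in> cball 0 R" "f h = f k" for h k
  proof -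
    have "\<bar>(h - k) \<bullet> blinfun_apply i y\<bar> \<le> a" if y: "y \<in> Y" for y
    proof -
      have "\<lfloor>(h \<bullet> blinfun_apply i y) / a\<rfloor> = \<lfloor>(k \<bullet> blinfun_apply i y) / a\<rfloor>"
        using fun_cong[OF \<open>f h = f k\<close>, of y] y by (simp add: f_def)
      then have "\<bar>(h \<bullet> blinfun_apply i y) / a - (k \<bullet> blinfun_apply i y) / a\<bar> \<le> 1" by linarith
      then show ?thesis using a by (simp add: inner_diff_left divide_simps abs_le_iff diff_divide_distrib[symmetric])
    qed
    then have "norm (gelfand_dual i (h - k)) \<le> a + e1 * norm (h - k)" using a by (intro Y(2)) auto
    also have "norm (h - k) \<le> 2 * \<bar>R\<bar>" using norm_triangle_ineq4[of h k] that by auto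
    then have "e1 * norm (h - k) \<le> e1 * (2 * \<bar>R\<bar>)" using e1(1) by (intro mult_left_mono) auto
    finally show ?thesis using e1(2) e by (simp add: gelfand_dual_diff dist_norm a_def)
  qed
  obtain k where k: "finite k" "gelfand_dual i ` cball 0 R \<subseteq> (\<Union>c\<in>k. ball c (e/2))"
    by (rule finite_net_image[OF fin close])
  \<comment> \<open>A net of the image need not cover its closure by open balls of the same radius;
    closed balls of radius \<open>e/2\<close> do, and they fit into open ones of radius
    \<open>e\<close>.\<close>
  have "closure (gelfand_dual i ` cball 0 R) \<subseteq> (\<Union>c\<in>k. cball c (e/2))"
  proof (rule closure_minimal)
    show "gelfand_dual i ` cball 0 R \<subseteq> (\<Union>c\<in>k. cball c (e/2))" using k(2) ball_subset_cball by blast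
    show "closed (\<Union>c\<in>k. cball c (e/2))" using k(1) by (intro closed_UN) auto
  qed
  also have "\<dots> \<subseteq> (\<Union>c\<in>k. ball c e)" using e by (intro UN_mono) (auto simp: subset_iff)
  finally show "\<exists>k. finite k \<and> closure (gelfand_dual i ` cball 0 R) \<subseteq> (\<Union>c\<in>k. ball c e)"
    using k(1) by blast
qed

section \<open>Continuous paths in H and their images in the Skorohod space\<close>

lemma mspace_C_metric:
  "mspace (C_metric T :: (real \<Rightarrow> 'h::metric_space) metric) = {x \<in> extensional {0..T}. continuous_on {0..T} x}"
proof -
  have "bounded (x ` {0..T})" if "continuous_on {0..T} x" for x :: "real \<Rightarrow> 'h"
    using that by (intro compact_imp_bounded compact_continuous_image) auto
  then show ?thesis by (auto simp: C_metric_def)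
qed

text \<open>Supremum distance below \<open>r\<close> forces distance below \<open>r\<close> at every
  time, so the set described contains a metric ball around each of its points. Openness can then be
  checked by pointwise estimates.\<close>

lemma openin_C_metricI:
  fixes U :: "(real \<Rightarrow> 'h::metric_space) set"
  assumes "T \<ge> 0" "U \<subseteq> mspace (C_metric T)"
    and "\<And>x. x \<in> U \<Longrightarrow> \<exists>r>0. \<forall>y\<in>mspace (C_metric T). (\<forall>t\<in>{0..T}. dist (x t) (y t) < r) \<longrightarrow> y \<in> U"
  shows "openin (mtopology_of (C_metric T)) U"
proof -
  have "\<exists>r>0. mball_of (C_metric T) x r \<subseteq> U" if x: "x \<in> U" for x
  proof -
    obtain r where r: "r > 0" "\<And>y. y\<in>mspace (C_metric T) \<Longrightarrow> (\<And>t. t\<in>{0..T} \<Longrightarrow> dist (x t) (y t) < r) \<Longrightarrow> y \<in> U"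
      using assms(3)[OF x] by blast
    have "y \<in> U" if y: "y \<in> mball_of (C_metric T) x r" for y
    proof (rule r(2))
      show ym: "y \<in> mspace (C_metric T)" using y by simp
      fix t assume t: "t \<in> {0..T}"
      have "mdist euclidean_metric (x t) (y t) \<le> mdist (C_metric T) x y"
        unfolding C_metric_def
        by (rule mdist_cfunspace_imp_mdist_le) (use x ym t assms(2) in \<open>auto simp: C_metric_def\<close>)
      then show "dist (x t) (y t) < r" using y by simp
    qed
    then show ?thesis using r(1) by blast
  qed
  then show ?thesis
    unfolding mtopology_of_def Metric_space.openin_mtopology[OF Metric_space_mspace_mdist]
    using assms(2) by (auto simp: mball_of_def)
qed

text \<open>The map \<open>gelfand_dual i\<close> is Lipschitz with constant \<open>norm i\<close>,
  and the uniform distance dominates the Skorohod one. Continuity makes the path map Borel, so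
  \<open>skorohod_law\<close> is a genuine image measure. The divisor \<open>norm i + 1\<close>
  covers \<open>i = 0\<close>.\<close>

lemma continuous_map_gelfand_path:
  fixes i :: "'y::real_normed_vector \<Rightarrow>\<^sub>L 'h::real_inner"
  assumes T: "T \<ge> 0"
  shows "continuous_map (mtopology_of (C_metric T)) (skorohod_topology T)
    (\<lambda>x. \<lambda>t\<in>{0..T}. gelfand_dual i (x t))" (is "continuous_map ?X _ ?G")
proof -
  have top: "topspace ?X = mspace (C_metric T)" by simp
  have cont: "continuous_on UNIV (gelfand_dual i)"
    unfolding continuous_on_iff
  proof (intro ballI allI impI)
    fix h and e :: real assume e: "0 < e"
    have "dist (gelfand_dual i k) (gelfand_dual i h) < e" if "dist k h < e / (norm i + 1)" for k
    proof -
      have "dist (gelfand_dual i k) (gelfand_dual i h) \<le> norm i * norm (k - h)"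
        unfolding dist_norm gelfand_dual_diff[symmetric] by (rule norm_gelfand_dual_le)
      also have "\<dots> \<le> (norm i + 1) * norm (k - h)" by (intro mult_right_mono) auto
      also have "\<dots> < e" using that by (simp add: dist_norm pos_less_divide_eq add_nonneg_pos mult.commute)
      finally show ?thesis .
    qed
    then show "\<exists>d>0. \<forall>k\<in>UNIV. dist k h < d \<longrightarrow> dist (gelfand_dual i k) (gelfand_dual i h) < e"
      using e by (intro exI[of _ "e / (norm i + 1)"]) (auto simp: add_nonneg_pos)
  qed
  have G: "?G x \<in> cadlag_space T" if "x \<in> mspace (C_metric T)" for x
  proof (rule continuous_in_cadlag_space)
    have "continuous_on {0..T} (gelfand_dual i \<circ> x)"
      using that cont by (intro continuous_on_compose) (auto simp: mspace_C_metric intro: continuous_on_subset)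
    then show "continuous_on {0..T} (?G x)" by (rule continuous_on_eq) auto
  qed auto
  show ?thesis
    unfolding continuous_map_def
  proof (intro conjI allI impI)
    show "?G \<in> topspace ?X \<rightarrow> topspace (skorohod_topology T)"
      using G by (auto simp: topspace_skorohod[OF T] top)
    fix U :: "(real \<Rightarrow> 'y \<Rightarrow>\<^sub>L real) set" assume U: "openin (skorohod_topology T) U"
    show "openin ?X {x \<in> topspace ?X. ?G x \<in> U}"
    proof (rule openin_C_metricI[OF T])
      fix x assume "x \<in> {x \<in> topspace ?X. ?G x \<in> U}"
      then have x: "x \<in> mspace (C_metric T)" "?G x \<in> U" by auto
      obtain r where r: "r > 0" "\<And>\<psi>. \<psi> \<in> cadlag_space T \<Longrightarrow> skorohod_dist T (?G x) \<psi> < r \<Longrightarrow> \<psi> \<in> U"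
        using U x(2) unfolding openin_skorohod_iff[OF T] by meson
      have "?G y \<in> U" if y: "y \<in> mspace (C_metric T)" and d: "\<And>t. t\<in>{0..T} \<Longrightarrow> dist (x t) (y t) < r/2 / (norm i + 1)" for y
      proof (rule r(2)[OF G[OF y]])
        have "norm (?G x t - ?G y t) \<le> r/2" if t: "t \<in> {0..T}" for t
        proof -
          have "norm (?G x t - ?G y t) \<le> norm i * norm (x t - y t)"
            using t by (simp add: gelfand_dual_diff[symmetric] norm_gelfand_dual_le)
          also have "\<dots> \<le> (norm i + 1) * norm (x t - y t)" by (intro mult_right_mono) auto
          also have "\<dots> < (norm i + 1) * (r/2 / (norm i + 1))"
            using d[OF t] by (intro mult_strict_left_mono) (auto simp: dist_norm add_nonneg_pos)
          also have "(norm i + 1) * (r/2 / (norm i + 1)) = r/2"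
            using norm_ge_zero[of i] by (metis add_nonneg_pos less_numeral_extra(1) less_numeral_extra(3) nonzero_mult_div_cancel_left times_divide_eq_right)
          finally show ?thesis by simp
        qed
        then have "skorohod_dist T (?G x) (?G y) \<le> r/2"
          by (intro skorohod_dist_le_uniform G x y T)
        then show "skorohod_dist T (?G x) (?G y) < r" using r(1) by simp
      qed
      moreover have "r/2 / (norm i + 1) > 0" using r(1) by (simp add: add_nonneg_pos)
      ultimately show "\<exists>r>0. \<forall>y\<in>mspace (C_metric T). (\<forall>t\<in>{0..T}. dist (x t) (y t) < r) \<longrightarrow>
          y \<in> {x \<in> topspace ?X. ?G x \<in> U}" unfolding top by blast
    qed auto
  qed
qed

section \<open>Crossing times of a real sequence\<close>

text \<open>The alternative \<open>j = N\<close> makes \<open>N\<close> the default when no further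
  move larger than \<open>c\<close> occurs. The value \<open>N\<close> alone does not reveal whether
  a crossing took place there, so later statements test the size of the increment instead.\<close>

primrec crossing :: "real \<Rightarrow> nat \<Rightarrow> (nat \<Rightarrow> real) \<Rightarrow> nat \<Rightarrow> nat" where
  "crossing c N x 0 = 0"
| "crossing c N x (Suc i) =
     (LEAST j. j = N \<or> crossing c N x i \<le> j \<and> c < \<bar>x j - x (crossing c N x i)\<bar>)"

lemma crossing_le: "crossing c N x i \<le> N"
  by (cases i) (auto intro: Least_le)

lemma crossing_Suc_cases:
  "crossing c N x (Suc i) = N \<or>
   crossing c N x i \<le> crossing c N x (Suc i) \<and>
   c < \<bar>x (crossing c N x (Suc i)) - x (crossing c N x i)\<bar>"
  unfolding crossing.simps by (rule LeastI[of _ N]) simp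

lemma crossing_mono: "crossing c N x i \<le> crossing c N x (Suc i)"
  using crossing_Suc_cases[of c N x i] crossing_le[of c N x i] by auto

lemma before_crossing:
  assumes "crossing c N x i \<le> k" "k < crossing c N x (Suc i)"
  shows "\<bar>x k - x (crossing c N x i)\<bar> \<le> c"
  using not_less_Least[OF assms(2)[unfolded crossing.simps]] assms(1) by auto

text \<open>For \<open>j < N\<close> the default is out of play, and crossing at \<open>j\<close> is
  decided by the values up to \<open>j\<close>. This is the source of the stopping property.\<close>

lemma crossing_Suc_eq_iff:
  assumes "j < N"
  shows "crossing c N x (Suc i) = j \<longleftrightarrow>
    (\<exists>a\<le>j. crossing c N x i = a \<and> c < \<bar>x j - x a\<bar> \<and> (\<forall>k\<in>{a..<j}. \<bar>x k - x a\<bar> \<le> c))"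
proof
  assume j: "crossing c N x (Suc i) = j"
  show "\<exists>a\<le>j. crossing c N x i = a \<and> c < \<bar>x j - x a\<bar> \<and> (\<forall>k\<in>{a..<j}. \<bar>x k - x a\<bar> \<le> c)"
    using crossing_Suc_cases[of c N x i] before_crossing[of c N x i] assms unfolding j by auto
next
  assume "\<exists>a\<le>j. crossing c N x i = a \<and> c < \<bar>x j - x a\<bar> \<and> (\<forall>k\<in>{a..<j}. \<bar>x k - x a\<bar> \<le> c)"
  then show "crossing c N x (Suc i) = j"
    unfolding crossing.simps using assms by (intro Least_equality) (force simp: not_le[symmetric])+
qed

text \<open>A small increment means that the next crossing is the default \<open>N\<close>; before
  \<open>N\<close> nothing has moved by more than \<open>c\<close>, and at \<open>N\<close> the
  assumption itself applies.\<close>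

lemma after_last_crossing:
  assumes "\<bar>x (crossing c N x (Suc i)) - x (crossing c N x i)\<bar> \<le> c"
    and "crossing c N x i \<le> k" "k \<le> N"
  shows "\<bar>x k - x (crossing c N x i)\<bar> \<le> c"
proof -
  have "crossing c N x (Suc i) = N" using crossing_Suc_cases[of c N x i] assms(1) by auto
  then show ?thesis using before_crossing[OF assms(2)] assms by (cases "k = N") auto
qed

text \<open>The first \<open>q\<close> gaps add up to at most \<open>N\<close>, so at most
  \<open>N / m \<le> q / 2\<close> of them exceed \<open>m\<close>. Gaps of length 0 after reaching
  \<open>N\<close> count as short.\<close>

lemma many_short_gaps:
  assumes "m > 0" "2 * N \<le> q * m"
  shows "real q \<le> 2 * (\<Sum>i<q. of_bool (crossing c N x (Suc i) \<le> crossing c N x i + m))"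
proof -
  let ?\<tau> = "crossing c N x"
  have "real m * (1 - of_bool (?\<tau> (Suc i) \<le> ?\<tau> i + m)) \<le> real (?\<tau> (Suc i)) - real (?\<tau> i)" for i
    using crossing_mono[of c N x i] by auto
  then have "(\<Sum>i<q. real m * (1 - of_bool (?\<tau> (Suc i) \<le> ?\<tau> i + m))) \<le>
      (\<Sum>i<q. real (?\<tau> (Suc i)) - real (?\<tau> i))"
    by (rule sum_mono)
  also have "\<dots> = real (?\<tau> q)" by (subst sum_lessThan_telescope) simp
  also have "\<dots> \<le> real N" using crossing_le by simp
  finally have "2 * (real m * (real q - (\<Sum>i<q. of_bool (?\<tau> (Suc i) \<le> ?\<tau> i + m)))) \<le> real (2 * N)"
    by (simp add: sum_distrib_left[symmetric] sum_subtractf)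
  also have "\<dots> \<le> real (q * m)" using assms(2) by (rule of_nat_mono)
  finally have "real m * (2 * (real q - (\<Sum>i<q. of_bool (?\<tau> (Suc i) \<le> ?\<tau> i + m)))) \<le> real m * real q"
    by (simp add: mult_ac)
  then have "2 * (real q - (\<Sum>i<q. of_bool (?\<tau> (Suc i) \<le> ?\<tau> i + m))) \<le> real q"
    using assms(1) by (subst (asm) mult_le_cancel_left_pos) auto
  then show ?thesis by simp
qed

text \<open>If consecutive crossings are more than m steps apart, two times at distance at most m
  are separated by at most one crossing.\<close>

lemma crossing_modulus:
  assumes last: "\<bar>x (crossing c N x (Suc n)) - x (crossing c N x n)\<bar> \<le> c"
    and gaps: "\<And>i. i < n \<Longrightarrow> crossing c N x i + m < crossing c N x (Suc i)"
    and step: "\<And>j. j < N \<Longrightarrow> \<bar>x (Suc j) - x j\<bar> \<le> e"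
    and ab: "a \<le> b" "b \<le> N" "b \<le> a + m" and "c \<ge> 0" "e \<ge> 0"
  shows "\<bar>x b - x a\<bar> \<le> 3 * c + e"
proof -
  let ?\<tau> = "crossing c N x"
  have ex: "\<exists>i. i \<le> n \<and> ?\<tau> i \<le> a" by (rule exI[of _ 0]) simp
  \<comment> \<open>The last crossing at or before \<open>a\<close>, among the first
    \<open>n\<close>.\<close>
  define i where "i = (GREATEST i. i \<le> n \<and> ?\<tau> i \<le> a)"
  have i: "i \<le> n" "?\<tau> i \<le> a"
    using GreatestI_ex_nat[OF ex, of n] unfolding i_def by auto
  have max: "j \<le> i" if "j \<le> n" "?\<tau> j \<le> a" for j
    unfolding i_def by (rule Greatest_le_nat[where b = n]) (use that in auto)
  have bound: "\<bar>x k - x (?\<tau> j)\<bar> \<le> c"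
    if "j \<le> n" "?\<tau> j \<le> k" "k \<le> N" "j < n \<Longrightarrow> k < ?\<tau> (Suc j)" for j k
    using that after_last_crossing[OF last] before_crossing[of c N x j k]
    by (cases "j = n") auto
  show ?thesis
  proof (cases "i = n \<or> b < ?\<tau> (Suc i)")
    case True
    then have "\<bar>x a - x (?\<tau> i)\<bar> \<le> c" "\<bar>x b - x (?\<tau> i)\<bar> \<le> c"
      using i ab by (auto intro!: bound)
    then show ?thesis using assms(7,8) by linarith
  next
    case False
    then have in': "i < n" "?\<tau> (Suc i) \<le> b" using i(1) by auto
    then have a_lt: "a < ?\<tau> (Suc i)" using max[of "Suc i"] by fastforce
    \<comment> \<open>The value at a crossing may overshoot the level, so the estimate passes
      through the index \<open>k\<close> just before it. The chain from \<open>a\<close> to crossing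
      \<open>i\<close>, to \<open>k\<close>, to crossing \<open>i + 1\<close>, to \<open>b\<close>
      costs \<open>c + c + e + c\<close>.\<close>
    then obtain k where k: "?\<tau> (Suc i) = Suc k" by (cases "?\<tau> (Suc i)") auto
    have "\<bar>x a - x (?\<tau> i)\<bar> \<le> c" by (rule bound) (use i ab a_lt in auto)
    moreover have "\<bar>x k - x (?\<tau> i)\<bar> \<le> c"
      by (rule bound) (use i ab a_lt k crossing_le[of c N x "Suc i"] in auto)
    moreover have "\<bar>x (?\<tau> (Suc i)) - x k\<bar> \<le> e"
      using step[of k] k crossing_le[of c N x "Suc i"] by simp
    moreover have "\<bar>x b - x (?\<tau> (Suc i))\<bar> \<le> c"
    proof (rule bound)
      show "b < ?\<tau> (Suc (Suc i))" if "Suc i < n" using gaps[OF that] a_lt ab by linarith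
    qed (use in' ab in auto)
    ultimately show ?thesis by linarith
  qed
qed

section \<open>Increments of a process on a finite grid\<close>

text \<open>The process is indexed by all natural numbers because it is evaluated at lags after
  times that may already equal \<open>N\<close>.\<close>

locale grid_process = prob_space M
  for M :: "'a measure" +
  fixes N :: nat and G :: "nat \<Rightarrow> 'a measure" and X :: "nat \<Rightarrow> 'a \<Rightarrow> real"
  assumes subalg: "\<And>j. subalgebra M (G j)"
    and filt: "\<And>j k. j \<le> k \<Longrightarrow> sets (G j) \<subseteq> sets (G k)"
    and adapted: "\<And>j. X j \<in> borel_measurable (G j)"
begin

text \<open>Measurability is asked only below \<open>N\<close>, which fits the default value of
  \<open>crossing\<close>; the event of value \<open>N\<close> is the complement of the
  others.\<close>

definition grid_time :: "('a \<Rightarrow> nat) \<Rightarrow> bool" where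
  "grid_time \<tau> \<longleftrightarrow> (\<forall>\<omega>\<in>space M. \<tau> \<omega> \<le> N) \<and> (\<forall>j<N. {\<omega>\<in>space M. \<tau> \<omega> = j} \<in> sets (G j))"

text \<open>The grid form of the Aldous condition: random starting times, but deterministic
  lags.\<close>

definition small_increments :: "real \<Rightarrow> real \<Rightarrow> nat \<Rightarrow> bool" where
  "small_increments e \<eta> K \<longleftrightarrow>
     (\<forall>\<tau>. grid_time \<tau> \<longrightarrow>
       (\<forall>k\<le>K. prob {\<omega>\<in>space M. e < \<bar>X (\<tau> \<omega> + k) \<omega> - X (\<tau> \<omega>) \<omega>\<bar>} \<le> \<eta>))"

lemma space_G [simp]: "space (G j) = space M"
  using subalg[of j] by (simp add: subalgebra_def)

lemma sets_G: "A \<in> sets (G j) \<Longrightarrow> A \<in> sets M"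
  using subalg[of j] by (auto simp: subalgebra_def)

lemma X_measurable [measurable]: "X j \<in> borel_measurable M"
  using measurable_from_subalg[OF subalg adapted] .

lemma X_measurable_G: "j \<le> k \<Longrightarrow> X j \<in> borel_measurable (G k)"
  using measurable_from_subalg[of "G k" "G j", OF _ adapted] filt[of j k]
  by (auto simp: subalgebra_def)

lemma grid_time_measurable:
  assumes "grid_time \<tau>"
  shows "\<tau> \<in> measurable M (count_space UNIV)"
proof (rule measurable_count_space_eq2_countable[THEN iffD2])
  have below: "{\<omega>\<in>space M. \<tau> \<omega> = j} \<in> sets M" if "j < N" for j
    using assms that sets_G unfolding grid_time_def by blast
  have "{\<omega>\<in>space M. \<tau> \<omega> = j} \<in> sets M" for j
  proof (cases j N rule: linorder_cases)
    case less
    then show ?thesis by (rule below)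
  next
    case equal
    then have "{\<omega>\<in>space M. \<tau> \<omega> = j} = space M - (\<Union>k<N. {\<omega>\<in>space M. \<tau> \<omega> = k})"
      using assms unfolding grid_time_def by (auto simp: order_le_less)
    then show ?thesis using below by auto
  next
    case greater
    then have "{\<omega>\<in>space M. \<tau> \<omega> = j} = {}" using assms unfolding grid_time_def by fastforce
    then show ?thesis by (simp only: sets.empty_sets)
  qed
  then show "\<tau> \<in> space M \<rightarrow> UNIV \<and> (\<forall>a\<in>UNIV. \<tau> -` {a} \<inter> space M \<in> sets M)"
    by (simp add: vimage_def Int_def conj_commute)
qed

lemma X_at_time:
  assumes "\<tau> \<in> measurable M (count_space UNIV)"
  shows "(\<lambda>\<omega>. X (\<tau> \<omega> + k) \<omega>) \<in> borel_measurable M" "(\<lambda>\<omega>. X (\<tau> \<omega>) \<omega>) \<in> borel_measurable M"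
  by (rule measurable_compose_countable[OF X_measurable[of "_ + k"] assms])
    (rule measurable_compose_countable[OF X_measurable assms])

lemma sets_increment:
  assumes "\<tau> \<in> measurable M (count_space UNIV)" "\<rho> \<in> measurable M (count_space UNIV)"
  shows "{\<omega>\<in>space M. c < \<bar>X (\<tau> \<omega> + k) \<omega> - X (\<rho> \<omega>) \<omega>\<bar>} \<in> sets M"
    "{\<omega>\<in>space M. c < \<bar>X (\<tau> \<omega>) \<omega> - X (\<rho> \<omega>) \<omega>\<bar>} \<in> sets M"
proof -
  have *: "{\<omega>\<in>space M. c < \<bar>f \<omega> - g \<omega>\<bar>} \<in> sets M"
    if [measurable]: "f \<in> borel_measurable M" "g \<in> borel_measurable M" for f g :: "'a \<Rightarrow> real"
    by measurable
  show "{\<omega>\<in>space M. c < \<bar>X (\<tau> \<omega> + k) \<omega> - X (\<rho> \<omega>) \<omega>\<bar>} \<in> sets M"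
    by (rule *[OF X_at_time(1)[OF assms(1)] X_at_time(2)[OF assms(2)]])
  show "{\<omega>\<in>space M. c < \<bar>X (\<tau> \<omega>) \<omega> - X (\<rho> \<omega>) \<omega>\<bar>} \<in> sets M"
    by (rule *[OF X_at_time(2)[OF assms(1)] X_at_time(2)[OF assms(2)]])
qed

lemma sets_close_increment:
  assumes [measurable]: "\<tau> \<in> measurable M (count_space UNIV)" "\<rho> \<in> measurable M (count_space UNIV)"
  shows "{\<omega>\<in>space M. \<tau> \<omega> \<le> \<rho> \<omega> + (m::nat) \<and> c < \<bar>X (\<tau> \<omega>) \<omega> - X (\<rho> \<omega>) \<omega>\<bar>} \<in> sets M"
proof (intro sets.sets_Collect_conj sets_increment assms)
  show "{\<omega>\<in>space M. \<tau> \<omega> \<le> \<rho> \<omega> + m} \<in> sets M"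
  proof -
    have "(\<lambda>\<omega>. real (\<tau> \<omega>)) \<in> borel_measurable M" "(\<lambda>\<omega>. real (\<rho> \<omega> + m)) \<in> borel_measurable M"
      by (rule measurable_compose[OF assms(1)], simp) (rule measurable_compose[OF assms(2)], simp)
    from borel_measurable_le[OF this] show ?thesis by (simp only: of_nat_le_iff)
  qed
qed

lemma sets_modulus_event:
  "{\<omega>\<in>space M. (\<forall>j<N. \<bar>X (Suc j) \<omega> - X j \<omega>\<bar> \<le> e) \<and>
      (\<exists>a\<le>N. \<exists>b\<le>N. a \<le> b \<and> b \<le> a + m' \<and> c < \<bar>X b \<omega> - X a \<omega>\<bar>)} \<in> sets M"
proof -
  have "{\<omega>\<in>space M. (\<forall>j\<in>{..<N}. \<bar>X (Suc j) \<omega> - X j \<omega>\<bar> \<le> e) \<and>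
      (\<exists>a\<in>{..N}. \<exists>b\<in>{..N}. (a \<le> b \<and> b \<le> a + m') \<and> c < \<bar>X b \<omega> - X a \<omega>\<bar>)} \<in> sets M"
    by (intro sets.sets_Collect_conj sets.sets_Collect_finite_All sets.sets_Collect_finite_Ex
        sets.sets_Collect_const finite_lessThan finite_atMost borel_measurable_le borel_measurable_less
        borel_measurable_abs borel_measurable_diff borel_measurable_const X_measurable)
  then show ?thesis by (simp add: Ball_def Bex_def conj_assoc)
qed

text \<open>By induction on \<open>i\<close>: once the value \<open>a\<close> of the preceding
  crossing is fixed, the event of crossing next at \<open>j\<close> involves only the process at
  indices from \<open>a\<close> to \<open>j\<close>.\<close>

lemma grid_time_crossing:
  "grid_time (\<lambda>\<omega>. crossing c N (\<lambda>j. X j \<omega>) i)"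
proof -
  have "{\<omega>\<in>space M. crossing c N (\<lambda>j. X j \<omega>) i = j} \<in> sets (G j)" if "j < N" for j
    using that
  proof (induction i arbitrary: j)
    case 0
    then show ?case using sets.top[of "G 0"] by (cases "j = 0") auto
  next
    case (Suc i)
    have "{\<omega>\<in>space M. crossing c N (\<lambda>j. X j \<omega>) (Suc i) = j} =
        (\<Union>a\<le>j. {\<omega>\<in>space M. crossing c N (\<lambda>j. X j \<omega>) i = a} \<inter>
          {\<omega>\<in>space (G j). c < \<bar>X j \<omega> - X a \<omega>\<bar> \<and> (\<forall>k\<in>{a..<j}. \<bar>X k \<omega> - X a \<omega>\<bar> \<le> c)})"
      unfolding crossing_Suc_eq_iff[OF Suc.prems] by auto
    also have "\<dots> \<in> sets (G j)"
    proof (rule sets.finite_UN)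
      fix a assume a: "a \<in> {..j}"
      have meas: "X k \<in> borel_measurable (G j)" if "k \<le> j" for k
        using X_measurable_G that .
      have "{\<omega>\<in>space M. crossing c N (\<lambda>j. X j \<omega>) i = a} \<in> sets (G j)"
        using Suc.IH[of a] Suc.prems a filt[of a j] by auto
      moreover have "{\<omega>\<in>space (G j). c < \<bar>X j \<omega> - X a \<omega>\<bar> \<and> (\<forall>k\<in>{a..<j}. \<bar>X k \<omega> - X a \<omega>\<bar> \<le> c)} \<in> sets (G j)"
      proof (intro sets.sets_Collect_conj sets.sets_Collect_finite_All)
        have [measurable]: "X a \<in> borel_measurable (G j)" "X j \<in> borel_measurable (G j)"
          using a meas by auto
        show "{\<omega>\<in>space (G j). c < \<bar>X j \<omega> - X a \<omega>\<bar>} \<in> sets (G j)" by measurable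
        fix k assume "k \<in> {a..<j}"
        then have [measurable]: "X k \<in> borel_measurable (G j)" using meas by auto
        show "{\<omega>\<in>space (G j). \<bar>X k \<omega> - X a \<omega>\<bar> \<le> c} \<in> sets (G j)" by measurable
      qed simp
      ultimately show "{\<omega>\<in>space M. crossing c N (\<lambda>j. X j \<omega>) i = a} \<inter>
          {\<omega>\<in>space (G j). c < \<bar>X j \<omega> - X a \<omega>\<bar> \<and> (\<forall>k\<in>{a..<j}. \<bar>X k \<omega> - X a \<omega>\<bar> \<le> c)} \<in> sets (G j)"
        by (rule sets.Int)
    qed simp
    finally show ?case .
  qed
  then show ?thesis by (simp add: grid_time_def crossing_le)
qed

text \<open>Both increments over k further steps would have to be small for some k; averaging over
  the shifts k turns the hypothesis on deterministic lags into one on the random lag.\<close>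

lemma increment_between_grid_times:
  assumes \<sigma>: "grid_time \<sigma>" and \<rho>: "grid_time \<rho>"
    and le: "\<And>\<omega>. \<omega> \<in> space M \<Longrightarrow> \<sigma> \<omega> \<le> \<rho> \<omega>"
    and small: "small_increments e \<eta> (2 * m)"
  shows "prob {\<omega>\<in>space M. \<rho> \<omega> \<le> \<sigma> \<omega> + m \<and> 2 * e < \<bar>X (\<rho> \<omega>) \<omega> - X (\<sigma> \<omega>) \<omega>\<bar>} \<le> 3 * \<eta>"
proof -
  note meas = grid_time_measurable[OF \<sigma>] grid_time_measurable[OF \<rho>]
  define A where "A = {\<omega>\<in>space M. \<rho> \<omega> \<le> \<sigma> \<omega> + m \<and> 2 * e < \<bar>X (\<rho> \<omega>) \<omega> - X (\<sigma> \<omega>) \<omega>\<bar>}"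
  define U where "U = (\<lambda>k. {\<omega>\<in>space M. e < \<bar>X (\<sigma> \<omega> + k) \<omega> - X (\<sigma> \<omega>) \<omega>\<bar>})"
  define V where "V = (\<lambda>k. {\<omega>\<in>space M. e < \<bar>X (\<rho> \<omega> + k) \<omega> - X (\<rho> \<omega>) \<omega>\<bar>})"
  have [measurable]: "A \<in> sets M" "\<And>k. U k \<in> sets M" "\<And>k. V k \<in> sets M"
    unfolding A_def U_def V_def by (intro sets_close_increment sets_increment meas)+
  have pU: "prob (U k) \<le> \<eta>" if "k \<le> 2 * m" for k
    using small \<sigma> that unfolding small_increments_def U_def by blast
  have pV: "prob (V k) \<le> \<eta>" if "k \<le> m" for k
    using small \<rho> that unfolding small_increments_def V_def by auto
  have \<eta>: "\<eta> \<ge> 0" using order_trans[OF measure_nonneg pU[of 0]] by simp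
  have pointwise: "real (m + 1) * indicator A \<omega> \<le>
      (\<Sum>k\<le>2 * m. indicator (U k) \<omega>) + (\<Sum>k\<le>m. indicator (V k) \<omega>)" for \<omega>
  proof (cases "\<omega> \<in> A")
    case True
    then have \<omega>: "\<omega> \<in> space M" by (simp add: A_def)
    define d where "d = \<rho> \<omega> - \<sigma> \<omega>"
    have d: "\<rho> \<omega> = \<sigma> \<omega> + d" "d \<le> m" using le[OF \<omega>] True by (auto simp: d_def A_def)
    \<comment> \<open>The index \<open>\<rho> \<omega> + k\<close> equals
      \<open>\<sigma> \<omega> + (d + k)\<close>, so the two increments share an endpoint. If both
      were at most \<open>e\<close>, the values at \<open>\<sigma>\<close> and \<open>\<rho>\<close>
      would differ by at most \<open>2 * e\<close>.\<close>
    have "1 \<le> indicator (U (d + k)) \<omega> + (indicator (V k) \<omega> :: real)" for k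
    proof (rule ccontr)
      assume "\<not> ?thesis"
      then have "\<omega> \<notin> U (d + k)" "\<omega> \<notin> V k" by (auto split: split_indicator_asm)
      then show False using True \<omega> by (auto simp: A_def U_def V_def d(1) add.assoc)
    qed
    then have "(\<Sum>k\<le>m. 1 :: real) \<le> (\<Sum>k\<le>m. indicator (U (d + k)) \<omega> + indicator (V k) \<omega>)"
      by (intro sum_mono)
    also have "\<dots> = (\<Sum>k\<in>(+) d ` {..m}. indicator (U k) \<omega>) + (\<Sum>k\<le>m. indicator (V k) \<omega>)"
      by (simp add: sum.distrib sum.reindex)
    \<comment> \<open>The random lag \<open>d\<close> disappears here, because all the shifted
      indices lie below \<open>2 * m\<close>; this is why lags up to \<open>2 * m\<close> are
      assumed small.\<close>
    also have "(\<Sum>k\<in>(+) d ` {..m}. indicator (U k) \<omega> :: real) \<le> (\<Sum>k\<le>2 * m. indicator (U k) \<omega>)"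
      using d(2) by (intro sum_mono2) auto
    finally show ?thesis using True by simp
  qed (simp add: sum_nonneg)
  have "real (m + 1) * prob A = expectation (\<lambda>\<omega>. real (m + 1) * indicator A \<omega>)" by simp
  also have "\<dots> \<le> expectation (\<lambda>\<omega>. (\<Sum>k\<le>2 * m. indicator (U k) \<omega>) + (\<Sum>k\<le>m. indicator (V k) \<omega>))"
    by (rule integral_mono[OF _ _ pointwise])
      (auto intro!: Bochner_Integration.integrable_add Bochner_Integration.integrable_sum
        integrable_real_indicator simp: emeasure_eq_measure)
  also have "\<dots> = (\<Sum>k\<le>2 * m. prob (U k)) + (\<Sum>k\<le>m. prob (V k))"
    by (subst Bochner_Integration.integral_add)
      (auto intro!: Bochner_Integration.integrable_sum integrable_real_indicator
        simp: emeasure_eq_measure Bochner_Integration.integral_sum)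
  also have "\<dots> \<le> (\<Sum>k\<le>2 * m. \<eta>) + (\<Sum>k\<le>m. \<eta>)"
    using pU pV by (intro add_mono sum_mono) auto
  \<comment> \<open>The two sums have \<open>2 * m + 1\<close> and \<open>m + 1\<close> terms,
    together at most \<open>3 * (m + 1)\<close>.\<close>
  also have "\<dots> \<le> real (m + 1) * (3 * \<eta>)" using \<eta> by (simp add: algebra_simps)
  finally have "prob A \<le> 3 * \<eta>" by (subst (asm) mult_le_cancel_left_pos) auto
  then show ?thesis by (simp add: A_def)
qed

text \<open>When all \<open>q\<close> increments are large, at least half of them occur over short
  gaps, each an event of probability at most \<open>3 * \<eta>\<close>. Taking expectations of this
  count, rather than a union bound, yields a bound free of \<open>q\<close>.\<close>

lemma many_crossings:
  assumes small: "small_increments e \<eta> (2 * m)" and "m > 0" "q > 0" "2 * N \<le> q * m"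
  defines "\<tau> \<equiv> (\<lambda>i \<omega>. crossing (2 * e) N (\<lambda>j. X j \<omega>) i)"
  shows "prob {\<omega>\<in>space M. \<forall>i<q. 2 * e < \<bar>X (\<tau> (Suc i) \<omega>) \<omega> - X (\<tau> i \<omega>) \<omega>\<bar>} \<le> 6 * \<eta>"
proof -
  have gt: "grid_time (\<tau> i)" for i unfolding \<tau>_def by (rule grid_time_crossing)
  note meas = grid_time_measurable[OF gt]
  define B where "B = {\<omega>\<in>space M. \<forall>i<q. 2 * e < \<bar>X (\<tau> (Suc i) \<omega>) \<omega> - X (\<tau> i \<omega>) \<omega>\<bar>}"
  define A where "A = (\<lambda>i. {\<omega>\<in>space M. \<tau> (Suc i) \<omega> \<le> \<tau> i \<omega> + m \<and>
      2 * e < \<bar>X (\<tau> (Suc i) \<omega>) \<omega> - X (\<tau> i \<omega>) \<omega>\<bar>})"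
  have [measurable]: "\<And>i. A i \<in> sets M"
    unfolding A_def by (intro sets_close_increment meas)
  have [measurable]: "B \<in> sets M"
  proof -
    have "{\<omega>\<in>space M. \<forall>i\<in>{..<q}. 2 * e < \<bar>X (\<tau> (Suc i) \<omega>) \<omega> - X (\<tau> i \<omega>) \<omega>\<bar>} \<in> sets M"
      by (intro sets.sets_Collect_finite_All sets_increment meas) simp
    then show ?thesis by (simp only: B_def Ball_def lessThan_iff)
  qed
  have pA: "prob (A i) \<le> 3 * \<eta>" for i
    unfolding A_def
    by (rule increment_between_grid_times[OF gt gt _ small]) (simp only: \<tau>_def crossing_mono)
  have pointwise: "real q * indicator B \<omega> \<le> 2 * (\<Sum>i<q. indicator (A i) \<omega>)" for \<omega>
  proof (cases "\<omega> \<in> B")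
    case True
    have "real q \<le> 2 * (\<Sum>i<q. of_bool (\<tau> (Suc i) \<omega> \<le> \<tau> i \<omega> + m))"
      unfolding \<tau>_def by (rule many_short_gaps) (use assms in auto)
    also have "(\<Sum>i<q. of_bool (\<tau> (Suc i) \<omega> \<le> \<tau> i \<omega> + m)) = (\<Sum>i<q. indicator (A i) \<omega> :: real)"
      using True by (intro sum.cong) (auto simp: A_def B_def indicator_def)
    finally show ?thesis using True by simp
  qed (simp add: sum_nonneg)
  have "real q * prob B = expectation (\<lambda>\<omega>. real q * indicator B \<omega>)" by simp
  also have "\<dots> \<le> expectation (\<lambda>\<omega>. 2 * (\<Sum>i<q. indicator (A i) \<omega>))"
    by (rule integral_mono[OF _ _ pointwise])
      (auto intro!: Bochner_Integration.integrable_sum integrable_real_indicator simp: emeasure_eq_measure)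
  also have "\<dots> = 2 * (\<Sum>i<q. prob (A i))"
    by (subst Bochner_Integration.integral_mult_right_zero, subst Bochner_Integration.integral_sum)
      (auto intro!: integrable_real_indicator simp: emeasure_eq_measure)
  also have "\<dots> \<le> 2 * (\<Sum>i<q. 3 * \<eta>)" using pA by (intro mult_left_mono sum_mono) auto
  also have "\<dots> = real q * (6 * \<eta>)" by simp
  finally have "prob B \<le> 6 * \<eta>" using assms(3) by (subst (asm) mult_le_cancel_left_pos) auto
  then show ?thesis by (simp add: B_def)
qed

text \<open>Two scales interact: \<open>m\<close> and \<open>\<eta>\<close> make \<open>q\<close> or
  more crossings unlikely, and \<open>m'\<close> and \<open>\<eta>'\<close> make it unlikely that
  any of the first \<open>q\<close> crossings come close together. The threshold is
  \<open>3 * (2 * e) + e\<close>, from crossing level \<open>2 * e\<close> and step bound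
  \<open>e\<close>.\<close>

lemma grid_modulus:
  assumes small: "small_increments e \<eta> (2 * m)" and m: "m > 0" "q > 0" "2 * N \<le> q * m"
    and small': "small_increments e \<eta>' (2 * m')" and e: "e \<ge> 0"
  shows "prob {\<omega>\<in>space M. (\<forall>j<N. \<bar>X (Suc j) \<omega> - X j \<omega>\<bar> \<le> e) \<and>
      (\<exists>a\<le>N. \<exists>b\<le>N. a \<le> b \<and> b \<le> a + m' \<and> 7 * e < \<bar>X b \<omega> - X a \<omega>\<bar>)} \<le> 6 * \<eta> + real q * (3 * \<eta>')"
    (is "prob ?W \<le> _")
proof -
  define \<tau> where "\<tau> = (\<lambda>i \<omega>. crossing (2 * e) N (\<lambda>j. X j \<omega>) i)"
  have gt: "grid_time (\<tau> i)" for i unfolding \<tau>_def by (rule grid_time_crossing)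
  note meas = grid_time_measurable[OF gt]
  define B where "B = {\<omega>\<in>space M. \<forall>i<q. 2 * e < \<bar>X (\<tau> (Suc i) \<omega>) \<omega> - X (\<tau> i \<omega>) \<omega>\<bar>}"
  define A where "A = (\<lambda>i. {\<omega>\<in>space M. \<tau> (Suc i) \<omega> \<le> \<tau> i \<omega> + m' \<and>
      2 * e < \<bar>X (\<tau> (Suc i) \<omega>) \<omega> - X (\<tau> i \<omega>) \<omega>\<bar>})"
  have [measurable]: "\<And>i. A i \<in> sets M"
    unfolding A_def by (intro sets_close_increment meas)
  have [measurable]: "B \<in> sets M"
  proof -
    have "{\<omega>\<in>space M. \<forall>i\<in>{..<q}. 2 * e < \<bar>X (\<tau> (Suc i) \<omega>) \<omega> - X (\<tau> i \<omega>) \<omega>\<bar>} \<in> sets M"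
      by (intro sets.sets_Collect_finite_All sets_increment meas) simp
    then show ?thesis by (simp only: B_def Ball_def lessThan_iff)
  qed
  have "?W \<subseteq> B \<union> (\<Union>i<q. A i)"
  proof
    fix \<omega> assume W: "\<omega> \<in> ?W"
    show "\<omega> \<in> B \<union> (\<Union>i<q. A i)"
    proof (rule ccontr)
      assume no: "\<omega> \<notin> B \<union> (\<Union>i<q. A i)"
      have ex: "\<exists>i. i < q \<and> \<bar>X (\<tau> (Suc i) \<omega>) \<omega> - X (\<tau> i \<omega>) \<omega>\<bar> \<le> 2 * e"
        using no W by (auto simp: B_def not_less)
      \<comment> \<open>Outside \<open>B\<close> some increment is small; the crossings before the
        first such index are genuine, and outside every \<open>A i\<close> their gaps exceed
        \<open>m'\<close>.\<close>
      define n where "n = (LEAST i. i < q \<and> \<bar>X (\<tau> (Suc i) \<omega>) \<omega> - X (\<tau> i \<omega>) \<omega>\<bar> \<le> 2 * e)"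
      have n: "n < q" "\<bar>X (\<tau> (Suc n) \<omega>) \<omega> - X (\<tau> n \<omega>) \<omega>\<bar> \<le> 2 * e"
        using LeastI_ex[OF ex] unfolding n_def by auto
      have gaps: "\<tau> i \<omega> + m' < \<tau> (Suc i) \<omega>" if i: "i < n" for i
      proof -
        have "2 * e < \<bar>X (\<tau> (Suc i) \<omega>) \<omega> - X (\<tau> i \<omega>) \<omega>\<bar>"
          using not_less_Least[OF i[unfolded n_def]] n(1) i by simp
        moreover have "\<omega> \<notin> A i" using no n(1) i by auto
        moreover have "\<omega> \<in> space M" using W by blast
        ultimately show ?thesis unfolding A_def by auto
      qed
      obtain a b where ab: "a \<le> b" "b \<le> N" "b \<le> a + m'" "7 * e < \<bar>X b \<omega> - X a \<omega>\<bar>"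
        using W by auto
      have "\<bar>X b \<omega> - X a \<omega>\<bar> \<le> 3 * (2 * e) + e"
        by (rule crossing_modulus[where x = "\<lambda>j. X j \<omega>" and c = "2 * e" and N = N and n = n and m = m'])
          (use n(2) gaps W ab e in \<open>auto simp: \<tau>_def\<close>)
      then show False using ab(4) by simp
    qed
  qed
  then have "prob ?W \<le> prob (B \<union> (\<Union>i<q. A i))" by (intro finite_measure_mono) auto
  also have "\<dots> \<le> prob B + prob (\<Union>i<q. A i)" by (intro measure_Un_le) auto
  also have "prob (\<Union>i<q. A i) \<le> (\<Sum>i<q. prob (A i))" by (intro measure_UNION_le) auto
  also have "\<dots> \<le> (\<Sum>i<q. 3 * \<eta>')"
  proof (rule sum_mono)
    fix i show "prob (A i) \<le> 3 * \<eta>'"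
      unfolding A_def
      by (rule increment_between_grid_times[OF gt gt _ small']) (simp only: \<tau>_def crossing_mono)
  qed
  also have "prob B \<le> 6 * \<eta>" unfolding B_def \<tau>_def by (rule many_crossings[OF small m])
  finally show ?thesis by simp
qed

end

section \<open>Continuous real processes and the Aldous condition\<close>

locale continuous_processes = filtered_prob_space M F
  for M :: "'a measure" and F :: "real \<Rightarrow> 'a measure" +
  fixes T :: real and Z :: "nat \<Rightarrow> 'a \<Rightarrow> real \<Rightarrow> real"
  assumes T: "T > 0"
    and cont: "\<And>n \<omega>. \<omega> \<in> space M \<Longrightarrow> continuous_on {0..T} (Z n \<omega>)"
    and adapted_Z: "\<And>n t. t \<in> {0..T} \<Longrightarrow> (\<lambda>\<omega>. Z n \<omega> t) \<in> borel_measurable (F t)"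
begin

definition oscillates :: "nat \<Rightarrow> real \<Rightarrow> real \<Rightarrow> 'a set" where
  "oscillates n \<delta> c =
     {\<omega>\<in>space M. \<exists>s\<in>{0..T}. \<exists>t\<in>{0..T}. \<bar>s - t\<bar> < \<delta> \<and> c < \<bar>Z n \<omega> s - Z n \<omega> t\<bar>}"

definition lag_event :: "nat \<Rightarrow> ('a \<Rightarrow> real) \<Rightarrow> real \<Rightarrow> real \<Rightarrow> 'a set" where
  "lag_event n \<gamma> \<delta> e =
     {\<omega>\<in>space M. e < \<bar>Z n \<omega> (min (\<gamma> \<omega> + \<delta>) T) - Z n \<omega> (\<gamma> \<omega>)\<bar>}"

definition time_in :: "('a \<Rightarrow> real) \<Rightarrow> bool" where
  "time_in \<gamma> \<longleftrightarrow> stopping_time F \<gamma> \<and> (\<forall>\<omega>\<in>space M. \<gamma> \<omega> \<in> {0..T})"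

lemma space_F_eq: "space (F t) = space M"
  using subalg[of t] by (simp add: subalgebra_def)

lemma Z_measurable: "t \<in> {0..T} \<Longrightarrow> (\<lambda>\<omega>. Z n \<omega> t) \<in> borel_measurable M"
  using measurable_from_subalg[OF subalg adapted_Z] .

text \<open>For \<open>s\<close> in the interval and \<open>N > 0\<close>, the index of the last
  point of the grid with mesh \<open>T / N\<close> that does not exceed \<open>s\<close>.\<close>

definition grid_index :: "nat \<Rightarrow> real \<Rightarrow> nat" where
  "grid_index N s = nat \<lfloor>s * real N / T\<rfloor>"

lemma grid_index_bounds:
  assumes "s \<in> {0..T}"
  shows "real (grid_index N s) \<le> s * real N / T" "s * real N / T < real (grid_index N s) + 1"
    "grid_index N s \<le> N"
proof -
  have 0: "0 \<le> s * real N / T" using assms T by simp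
  show "real (grid_index N s) \<le> s * real N / T" "s * real N / T < real (grid_index N s) + 1"
    using 0 by (simp_all add: grid_index_def)
  have "s * real N / T \<le> real N" using mult_right_mono[of s T "real N"] assms T by (simp add: divide_simps mult.commute)
  then show "grid_index N s \<le> N" unfolding grid_index_def by linarith
qed

lemma grid_point_tendsto:
  assumes "s \<in> {0..T}"
  shows "(\<lambda>N. T * real (grid_index N s) / real N) \<longlonglongrightarrow> s"
proof (rule tendsto_sandwich)
  show "(\<lambda>N. s - T / real N) \<longlonglongrightarrow> s" by real_asymp
  show "(\<lambda>N. s) \<longlonglongrightarrow> s" by simp
  show "\<forall>\<^sub>F N in sequentially. s - T / real N \<le> T * real (grid_index N s) / real N"
    using eventually_gt_at_top[of 0]
  proof eventually_elim
    case (elim N)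
    have "T * (s * real N / T) \<le> T * (real (grid_index N s) + 1)"
      using grid_index_bounds(2)[OF assms, of N] T by (intro mult_left_mono) auto
    then have "(s * real N - T) / real N \<le> T * real (grid_index N s) / real N"
      using T by (intro divide_right_mono) (auto simp: algebra_simps)
    then show ?case using elim by (simp add: diff_divide_distrib)
  qed
  show "\<forall>\<^sub>F N in sequentially. T * real (grid_index N s) / real N \<le> s"
    using eventually_gt_at_top[of 0]
  proof eventually_elim
    case (elim N)
    have "T * real (grid_index N s) \<le> T * (s * real N / T)"
      using grid_index_bounds(1)[OF assms, of N] T by (intro mult_left_mono) auto
    then show ?case using elim T by (simp add: field_simps)
  qed
qed

lemma grid_point_range: "k \<le> N \<Longrightarrow> T * real k / real N \<in> {0..T}"
  using T by (cases "N = 0") (auto simp: divide_simps)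

lemma path_grid_tendsto:
  assumes "\<omega> \<in> space M" "s \<in> {0..T}"
  shows "(\<lambda>N. Z n \<omega> (T * real (grid_index N s) / real N)) \<longlonglongrightarrow> Z n \<omega> s"
  by (rule continuous_on_tendsto_compose[OF cont[OF assms(1)] grid_point_tendsto[OF assms(2)] assms(2)])
    (intro always_eventually allI grid_point_range grid_index_bounds(3)[OF assms(2)])

text \<open>Both conditions on \<open>s\<close> and \<open>t\<close> are strict and the paths are
  continuous, so the times may be replaced by points of a fine enough grid; the event is a countable
  union.\<close>

lemma sets_oscillates: "oscillates n \<delta> c \<in> sets M"
proof -
  define Q where "Q = (\<lambda>N. {\<omega>\<in>space M. \<exists>a\<in>{..N}. \<exists>b\<in>{..N}.
      \<bar>T * real a / real N - T * real b / real N\<bar> < \<delta> \<and>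
      c < \<bar>Z n \<omega> (T * real a / real N) - Z n \<omega> (T * real b / real N)\<bar>})"
  have "oscillates n \<delta> c = (\<Union>N. Q N)"
  proof
    show "(\<Union>N. Q N) \<subseteq> oscillates n \<delta> c"
    proof
      fix \<omega> assume "\<omega> \<in> (\<Union>N. Q N)"
      then obtain N a b where "\<omega> \<in> space M" "a \<le> N" "b \<le> N"
        "\<bar>T * real a / real N - T * real b / real N\<bar> < \<delta>"
        "c < \<bar>Z n \<omega> (T * real a / real N) - Z n \<omega> (T * real b / real N)\<bar>"
        unfolding Q_def by auto
      then show "\<omega> \<in> oscillates n \<delta> c"
        using grid_point_range unfolding oscillates_def by blast
    qed
    show "oscillates n \<delta> c \<subseteq> (\<Union>N. Q N)"
    proof
      fix \<omega> assume "\<omega> \<in> oscillates n \<delta> c"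
      then obtain s t where st: "s \<in> {0..T}" "t \<in> {0..T}" "\<bar>s - t\<bar> < \<delta>"
        "c < \<bar>Z n \<omega> s - Z n \<omega> t\<bar>" and \<omega>: "\<omega> \<in> space M"
        unfolding oscillates_def by auto
      let ?g = "\<lambda>N s. T * real (grid_index N s) / real N"
      have "\<forall>\<^sub>F N in sequentially. \<bar>?g N s - ?g N t\<bar> < \<delta>"
        by (rule order_tendstoD(2)[OF _ st(3)])
          (intro tendsto_intros tendsto_rabs tendsto_diff grid_point_tendsto st)
      moreover have "\<forall>\<^sub>F N in sequentially. c < \<bar>Z n \<omega> (?g N s) - Z n \<omega> (?g N t)\<bar>"
        by (rule order_tendstoD(1)[OF _ st(4)])
          (intro tendsto_rabs tendsto_diff path_grid_tendsto st \<omega>)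
      ultimately have "\<forall>\<^sub>F N in sequentially. \<bar>?g N s - ?g N t\<bar> < \<delta> \<and> c < \<bar>Z n \<omega> (?g N s) - Z n \<omega> (?g N t)\<bar>"
        by (rule eventually_conj)
      then obtain N where "\<bar>?g N s - ?g N t\<bar> < \<delta> \<and> c < \<bar>Z n \<omega> (?g N s) - Z n \<omega> (?g N t)\<bar>"
        by (auto simp: eventually_sequentially)
      then have "\<omega> \<in> Q N"
        unfolding Q_def using \<omega> grid_index_bounds(3)[OF st(1), of N] grid_index_bounds(3)[OF st(2), of N]
        by blast
      then show "\<omega> \<in> (\<Union>N. Q N)" by blast
    qed
  qed
  moreover have "Q N \<in> sets M" for N
    unfolding Q_def
    by (intro sets.sets_Collect_conj sets.sets_Collect_finite_Ex sets.sets_Collect_const finite_atMost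
        borel_measurable_less borel_measurable_abs borel_measurable_diff borel_measurable_const
        Z_measurable grid_point_range) auto
  ultimately show ?thesis by auto
qed

text \<open>The events for \<open>\<delta> = 1 / (k + 1)\<close> decrease to the empty set, as each
  path is uniformly continuous. The resulting \<open>\<delta>\<close> depends on
  \<open>n\<close>.\<close>

lemma single_process_modulus:
  assumes "c > 0" "\<eta> > 0"
  shows "\<exists>\<delta>>0. prob (oscillates n \<delta> c) < \<eta>"
proof -
  define A where "A = (\<lambda>k. oscillates n (1 / real (Suc k)) c)"
  have "decseq A"
    unfolding A_def
  proof (rule decseq_SucI)
    fix k show "oscillates n (1 / real (Suc (Suc k))) c \<subseteq> oscillates n (1 / real (Suc k)) c"
    proof
      fix \<omega> assume "\<omega> \<in> oscillates n (1 / real (Suc (Suc k))) c"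
      moreover have "1 / real (Suc (Suc k)) \<le> 1 / real (Suc k)" by (simp add: divide_simps)
      ultimately show "\<omega> \<in> oscillates n (1 / real (Suc k)) c"
        unfolding oscillates_def by (auto intro: less_le_trans)
    qed
  qed
  moreover have "range A \<subseteq> sets M" using sets_oscillates by (auto simp: A_def)
  ultimately have "(\<lambda>k. prob (A k)) \<longlonglongrightarrow> prob (\<Inter>k. A k)"
    by (intro finite_Lim_measure_decseq)
  moreover have "(\<Inter>k. A k) = {}"
  proof (rule ccontr)
    assume "\<not> ?thesis"
    then obtain \<omega> where \<omega>: "\<And>k. \<omega> \<in> A k" by blast
    then have sp: "\<omega> \<in> space M" unfolding A_def oscillates_def by blast
    have "uniformly_continuous_on {0..T} (Z n \<omega>)"
      by (intro compact_uniformly_continuous cont sp) simp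
    then obtain d where d: "d > 0" "\<And>s t. s\<in>{0..T} \<Longrightarrow> t\<in>{0..T} \<Longrightarrow> dist s t < d \<Longrightarrow> dist (Z n \<omega> s) (Z n \<omega> t) < c"
      unfolding uniformly_continuous_on_def using assms(1) by metis
    obtain k where "1 / real (Suc k) < d" using d(1) by (metis nat_approx_posE)
    then show False using \<omega>[of k] d(2) unfolding A_def oscillates_def
      by (fastforce simp: dist_real_def)
  qed
  ultimately have "\<forall>\<^sub>F k in sequentially. prob (A k) < \<eta>"
    using assms(2) by (intro order_tendstoD(2)) auto
  then show ?thesis unfolding A_def eventually_sequentially
    by (metis order_refl zero_less_divide_1_iff of_nat_0_less_iff zero_less_Suc)
qed

lemma lag_event_subset:
  assumes "time_in \<gamma>" "0 < \<delta>" "\<delta> < d"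
  shows "lag_event n \<gamma> \<delta> e \<subseteq> oscillates n d e"
proof
  fix \<omega> assume \<omega>: "\<omega> \<in> lag_event n \<gamma> \<delta> e"
  then have "\<gamma> \<omega> \<in> {0..T}" using assms(1) by (auto simp: lag_event_def time_in_def)
  moreover from this have "min (\<gamma> \<omega> + \<delta>) T \<in> {0..T}" "\<bar>min (\<gamma> \<omega> + \<delta>) T - \<gamma> \<omega>\<bar> < d"
    using assms(2,3) by auto
  ultimately show "\<omega> \<in> oscillates n d e" using \<omega>
    unfolding lag_event_def oscillates_def by blast
qed

text \<open>For each n pick a stopping time that violates the bound at a nearly minimal lag. A single
  process has a positive minimal violating lag, and the hypothesis for the chosen sequence of
  stopping times bounds these lags away from 0 uniformly in n.\<close>

lemma aldous_uniform:
  assumes hyp: "\<And>\<gamma>. (\<And>n. time_in (\<gamma> n)) \<Longrightarrow>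
      ((\<lambda>\<delta>. SUP n. prob (lag_event n (\<gamma> n) \<delta> e)) \<longlongrightarrow> 0) (at_right 0)"
    and e: "e > 0" and \<eta>: "\<eta> > 0"
  shows "\<exists>d>0. \<forall>n \<gamma> \<delta>. time_in \<gamma> \<longrightarrow> 0 < \<delta> \<longrightarrow> \<delta> < d \<longrightarrow> prob (lag_event n \<gamma> \<delta> e) \<le> \<eta>"
proof -
  define D where "D = (\<lambda>n. {\<delta>. 0 < \<delta> \<and> (\<exists>\<gamma>. time_in \<gamma> \<and> \<eta> < prob (lag_event n \<gamma> \<delta> e))})"
  \<comment> \<open>Serves as the chosen stopping time for those \<open>n\<close> that have no
    violating lag.\<close>
  have time0: "time_in (\<lambda>_. 0)" using T by (auto simp: time_in_def intro: stopping_time_const)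
  have "\<exists>\<gamma> \<delta>. time_in \<gamma> \<and> (D n \<noteq> {} \<longrightarrow> 0 < \<delta> \<and> \<eta> < prob (lag_event n \<gamma> \<delta> e) \<and> (\<forall>x\<in>D n. \<delta> \<le> 2 * x))" for n
  proof (cases "D n = {}")
    case True
    then show ?thesis using time0 by blast
  next
    case False
    obtain d where d: "d > 0" "prob (oscillates n d e) < \<eta>"
      using single_process_modulus[OF e \<eta>] by blast
    have ge: "d \<le> x" if x: "x \<in> D n" for x
    proof (rule ccontr)
      assume "\<not> d \<le> x"
      moreover obtain \<gamma> where "time_in \<gamma>" "\<eta> < prob (lag_event n \<gamma> x e)" "0 < x"
        using x by (auto simp: D_def)
      ultimately show False
        using lag_event_subset[of \<gamma> x d n e] d(2) finite_measure_mono[OF _ sets_oscillates, of "lag_event n \<gamma> x e" n d e]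
        by auto
    qed
    have bdd: "bdd_below (D n)" using ge by (meson bdd_belowI)
    have "d \<le> Inf (D n)" using False ge by (rule cInf_greatest)
    \<comment> \<open>The infimum need not be attained; being positive, it has a violating lag below
      its double.\<close>
    then have "Inf (D n) < 2 * Inf (D n)" using d(1) by simp
    then obtain \<delta> where \<delta>: "\<delta> \<in> D n" "\<delta> < 2 * Inf (D n)" using cInf_lessD[OF False] by blast
    then have "\<delta> \<le> 2 * x" if "x \<in> D n" for x using cInf_lower[OF that bdd] by simp
    then show ?thesis using \<delta>(1) unfolding D_def by blast
  qed
  then obtain \<gamma> \<delta> where \<gamma>: "\<And>n. time_in (\<gamma> n)"
    and \<delta>: "\<And>n x. x \<in> D n \<Longrightarrow> 0 < \<delta> n \<and> \<eta> < prob (lag_event n (\<gamma> n) (\<delta> n) e) \<and> \<delta> n \<le> 2 * x"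
    by (metis empty_iff)
  have "\<forall>\<^sub>F x in at_right 0. (SUP n. prob (lag_event n (\<gamma> n) x e)) < \<eta>"
    using hyp[OF \<gamma>] \<eta> by (rule order_tendstoD(2))
  then obtain b where b: "b > 0" "\<And>x. 0 < x \<Longrightarrow> x < b \<Longrightarrow> (SUP n. prob (lag_event n (\<gamma> n) x e)) < \<eta>"
    unfolding eventually_at_right_field by auto
  \<comment> \<open>Halving \<open>b\<close> absorbs the factor 2: a violating lag
    \<open>x < b/2\<close> makes the chosen lag \<open>\<delta> n \<le> 2 * x\<close> smaller than
    \<open>b\<close>.\<close>
  have "prob (lag_event n \<gamma>' x e) \<le> \<eta>" if "time_in \<gamma>'" "0 < x" "x < b/2" for n \<gamma>' x
  proof (rule ccontr)
    assume "\<not> ?thesis"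
    then have "x \<in> D n" using that by (auto simp: D_def)
    from \<delta>[OF this] have *: "0 < \<delta> n" "\<eta> < prob (lag_event n (\<gamma> n) (\<delta> n) e)" "\<delta> n < b"
      using that(3) by auto
    have "prob (lag_event n (\<gamma> n) (\<delta> n) e) \<le> (SUP k. prob (lag_event k (\<gamma> k) (\<delta> n) e))"
      by (intro cSUP_upper bdd_aboveI2[of _ _ 1]) auto
    also have "\<dots> < \<eta>" by (rule b(2)[OF *(1,3)])
    finally show False using *(2) by simp
  qed
  then show ?thesis using b(1) by (intro exI[of _ "b/2"]) auto
qed

text \<open>For \<open>t < T\<close> the event of having stopped by \<open>t\<close> is a finite
  union over grid points up to \<open>t\<close>. For \<open>t \<ge> T\<close> it is the whole space,
  which takes care of the value \<open>N\<close>.\<close>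

lemma stopping_time_grid:
  assumes \<tau>: "\<And>\<omega>. \<omega> \<in> space M \<Longrightarrow> \<tau> \<omega> \<le> N"
    "\<And>j. j < N \<Longrightarrow> {\<omega>\<in>space M. \<tau> \<omega> = j} \<in> sets (F (T * real j / real N))" and N: "N > 0"
  shows "time_in (\<lambda>\<omega>. T * real (\<tau> \<omega>) / real N)"
  unfolding time_in_def
proof (intro conjI ballI)
  show "T * real (\<tau> \<omega>) / real N \<in> {0..T}" if "\<omega> \<in> space M" for \<omega>
    using grid_point_range[OF \<tau>(1)[OF that]] .
  show "stopping_time F (\<lambda>\<omega>. T * real (\<tau> \<omega>) / real N)"
    unfolding stopping_time_def
  proof
    fix t
    have "{\<omega>\<in>space M. T * real (\<tau> \<omega>) / real N \<le> t} \<in> sets (F t)"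
    proof (cases "T \<le> t")
      case True
      then have "{\<omega>\<in>space M. T * real (\<tau> \<omega>) / real N \<le> t} = space (F t)"
        using grid_point_range[OF \<tau>(1)] by (fastforce simp: space_F_eq)
      then show ?thesis by simp
    next
      case False
      have "{\<omega>\<in>space M. T * real (\<tau> \<omega>) / real N \<le> t} =
          (\<Union>j\<in>{j. j < N \<and> T * real j / real N \<le> t}. {\<omega>\<in>space M. \<tau> \<omega> = j})"
        using \<tau>(1) False N by (force simp: order_le_less)
      also have "\<dots> \<in> sets (F t)"
      proof (rule sets.finite_UN)
        fix j assume "j \<in> {j. j < N \<and> T * real j / real N \<le> t}"
        then show "{\<omega>\<in>space M. \<tau> \<omega> = j} \<in> sets (F t)"
          using \<tau>(2)[of j] sets_F_mono[of "T * real j / real N" t] by auto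
      qed simp
      finally show ?thesis .
    qed
    then show "Measurable.pred (F t) (\<lambda>\<omega>. T * real (\<tau> \<omega>) / real N \<le> t)"
      by (simp add: pred_def space_F_eq)
  qed
qed

end

section \<open>Passage from grids to continuous time\<close>

context continuous_processes
begin

text \<open>Freezing the process at \<open>T\<close> for indices above \<open>N\<close> matches the
  truncation of the lagged time in \<open>lag_event\<close>.\<close>

definition grid_value :: "nat \<Rightarrow> nat \<Rightarrow> nat \<Rightarrow> 'a \<Rightarrow> real" where
  "grid_value n N j \<omega> = Z n \<omega> (min (T * real j / real N) T)"

lemma grid_value_eq: "j \<le> N \<Longrightarrow> grid_value n N j \<omega> = Z n \<omega> (T * real j / real N)"
  using grid_point_range[of j N] by (simp add: grid_value_def min_absorb1)

lemma grid_process_grid_value: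
  "grid_process M (\<lambda>j. F (T * real j / real N)) (grid_value n N)"
proof (unfold_locales)
  fix j k :: nat
  show "subalgebra M (F (T * real j / real N))" by (rule subalg)
  have mono: "sets (F s) \<subseteq> sets (F t)" if "s \<le> t" for s t using sets_F_mono[OF that] .
  show "sets (F (T * real j / real N)) \<subseteq> sets (F (T * real k / real N))" if "j \<le> k"
    using that T by (intro mono divide_right_mono mult_left_mono) auto
  have "(\<lambda>\<omega>. Z n \<omega> (min (T * real j / real N) T)) \<in> borel_measurable (F (min (T * real j / real N) T))"
    using T by (intro adapted_Z) auto
  moreover have "subalgebra (F (T * real j / real N)) (F (min (T * real j / real N) T))"
    using mono[of "min (T * real j / real N) T" "T * real j / real N"]
    by (simp add: subalgebra_def space_F_eq)
  ultimately have "(\<lambda>\<omega>. Z n \<omega> (min (T * real j / real N) T)) \<in> borel_measurable (F (T * real j / real N))"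
    by (rule measurable_from_subalg[rotated])
  then show "grid_value n N j \<in> borel_measurable (F (T * real j / real N))"
    unfolding grid_value_def .
qed

text \<open>A lag of \<open>k\<close> steps is the deterministic lag \<open>T * k / N\<close>. The
  case \<open>k = 0\<close> is separate because the assumption covers positive lags only.\<close>

lemma grid_small_increments:
  assumes small: "\<And>\<gamma> \<delta>. time_in \<gamma> \<Longrightarrow> 0 < \<delta> \<Longrightarrow> \<delta> < d \<Longrightarrow> prob (lag_event n \<gamma> \<delta> e) \<le> \<eta>"
    and N: "N > 0" and K: "T * real K / real N < d" and e: "e \<ge> 0" and \<eta>: "\<eta> \<ge> 0"
  shows "grid_process.small_increments M N (\<lambda>j. F (T * real j / real N)) (grid_value n N) e \<eta> K"
proof -
  interpret G: grid_process M N "\<lambda>j. F (T * real j / real N)" "grid_value n N"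
    by (rule grid_process_grid_value)
  have "prob {\<omega>\<in>space M. e < \<bar>grid_value n N (\<tau> \<omega> + k) \<omega> - grid_value n N (\<tau> \<omega>) \<omega>\<bar>} \<le> \<eta>"
    if \<tau>: "G.grid_time \<tau>" and k: "k \<le> K" for \<tau> k
  proof (cases "k = 0")
    case True
    then show ?thesis using e \<eta> by simp
  next
    case False
    let ?\<gamma> = "\<lambda>\<omega>. T * real (\<tau> \<omega>) / real N"
    have "time_in ?\<gamma>"
      using \<tau> N unfolding G.grid_time_def by (intro stopping_time_grid) auto
    moreover have "0 < T * real k / real N" using False T N by simp
    moreover have "T * real k / real N < d"
    proof -
      have "T * real k / real N \<le> T * real K / real N"
        using k T by (intro divide_right_mono mult_left_mono) auto
      then show ?thesis using K by simp
    qed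
    ultimately have "prob (lag_event n ?\<gamma> (T * real k / real N) e) \<le> \<eta>" by (rule small)
    moreover have "{\<omega>\<in>space M. e < \<bar>grid_value n N (\<tau> \<omega> + k) \<omega> - grid_value n N (\<tau> \<omega>) \<omega>\<bar>} =
        lag_event n ?\<gamma> (T * real k / real N) e"
      using \<tau> by (auto simp: lag_event_def grid_value_eq G.grid_time_def grid_value_def[of _ _ "_ + _"]
          distrib_left add_divide_distrib)
    ultimately show ?thesis by simp
  qed
  then show ?thesis by (simp add: G.small_increments_def)
qed

text \<open>The tolerances \<open>\<eta> / 12\<close> and \<open>\<eta> / (6 * q)\<close> make both
  terms of \<open>grid_modulus\<close> equal to \<open>\<eta> / 2\<close>. As \<open>d1\<close>,
  \<open>q\<close> and \<open>d2\<close> depend neither on the grid nor on \<open>n\<close>, the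
  estimate survives refinement.\<close>

lemma uniform_modulus:
  assumes hyp: "\<And>e \<gamma>. e > 0 \<Longrightarrow> (\<And>n. time_in (\<gamma> n)) \<Longrightarrow>
      ((\<lambda>\<delta>. SUP n. prob (lag_event n (\<gamma> n) \<delta> e)) \<longlongrightarrow> 0) (at_right 0)"
    and e: "e > 0" and \<eta>: "\<eta> > 0"
  shows "\<exists>\<delta>>0. \<forall>n. prob (oscillates n \<delta> (7 * e)) \<le> \<eta>"
proof -
  obtain d1 where d1: "d1 > 0" "\<And>n \<gamma> \<delta>. time_in \<gamma> \<Longrightarrow> 0 < \<delta> \<Longrightarrow> \<delta> < d1 \<Longrightarrow> prob (lag_event n \<gamma> \<delta> e) \<le> \<eta> / 12"
    using aldous_uniform[OF hyp[OF e] e, of "\<eta> / 12"] \<eta> by auto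
  \<comment> \<open>For fine grids \<open>m N\<close> is at least \<open>d1 * N / (8 * T)\<close>,
    so this \<open>q\<close> satisfies \<open>2 * N \<le> q * m N\<close> whatever the mesh.\<close>
  define q where "q = nat \<lceil>16 * T / d1\<rceil> + 1"
  have q: "q > 0" "16 * T / d1 \<le> real q" unfolding q_def by linarith+
  obtain d2 where d2: "d2 > 0" "\<And>n \<gamma> \<delta>. time_in \<gamma> \<Longrightarrow> 0 < \<delta> \<Longrightarrow> \<delta> < d2 \<Longrightarrow> prob (lag_event n \<gamma> \<delta> e) \<le> \<eta> / (6 * real q)"
    using aldous_uniform[OF hyp[OF e] e, of "\<eta> / (6 * real q)"] \<eta> q(1) by auto
  have "prob (oscillates n (d2 / 8) (7 * e)) \<le> \<eta>" for n
  proof -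
    \<comment> \<open>A block of \<open>m N\<close> steps lasts at most \<open>d1 / 4\<close>, so
      lags of up to \<open>2 * m N\<close> steps stay below \<open>d1\<close>; likewise
      \<open>m'\<close> with \<open>d2\<close>.\<close>
    define m where "m = (\<lambda>N. nat \<lfloor>d1 * real N / (4 * T)\<rfloor>)"
    define m' where "m' = (\<lambda>N. nat \<lfloor>d2 * real N / (4 * T)\<rfloor>)"
    define V where "V = (\<lambda>N. {\<omega>\<in>space M.
        (\<forall>j<N. \<bar>grid_value n N (Suc j) \<omega> - grid_value n N j \<omega>\<bar> \<le> e) \<and>
        (\<exists>a\<le>N. \<exists>b\<le>N. a \<le> b \<and> b \<le> a + m' N \<and> 7 * e < \<bar>grid_value n N b \<omega> - grid_value n N a \<omega>\<bar>)})"
    have V_sets: "V N \<in> sets M" for N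
      unfolding V_def by (rule grid_process.sets_modulus_event[OF grid_process_grid_value])
    \<comment> \<open>From here on \<open>d1 * N / (8 * T)\<close> is at least 1, so rounding down
      loses at most half of \<open>d1 * N / (4 * T)\<close> and \<open>m N\<close> is
      positive.\<close>
    define N0 where "N0 = nat \<lceil>8 * T / d1\<rceil> + 1"
    have V_prob: "prob (V N) \<le> \<eta>" if "N \<ge> N0" for N
    proof -
      have N: "N > 0" "8 * T / d1 \<le> real N" using that unfolding N0_def by linarith+
      have fl: "real (m N) \<le> d1 * real N / (4 * T)" "d1 * real N / (4 * T) < real (m N) + 1"
        "real (m' N) \<le> d2 * real N / (4 * T)"
        using d1(1) d2(1) T by (simp_all add: m_def m'_def)
      have "1 \<le> d1 * real N / (8 * T)" using N(2) d1(1) T by (simp add: field_simps)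
      moreover have "d1 * real N / (4 * T) = 2 * (d1 * real N / (8 * T))" by simp
      ultimately have ml: "d1 * real N / (8 * T) \<le> real (m N)" using fl(2) by linarith
      have m0: "m N > 0" using ml \<open>1 \<le> d1 * real N / (8 * T)\<close> by linarith
      have "real (2 * N) = (16 * T / d1) * (d1 * real N / (8 * T))" using d1(1) T by (simp add: field_simps)
      also have "\<dots> \<le> real q * real (m N)" using q(2) ml d1(1) T by (intro mult_mono) auto
      finally have qm: "2 * N \<le> q * m N" by (simp only: of_nat_mult[symmetric] of_nat_le_iff)
      have "T * real (2 * m N) \<le> T * (2 * (d1 * real N / (4 * T)))"
        using fl(1) T by (intro mult_left_mono) auto
      also have "\<dots> < d1 * real N" using d1(1) T N(1) by (simp add: field_simps)
      finally have K1: "T * real (2 * m N) / real N < d1" using N(1) by (simp add: pos_divide_less_eq)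
      have "T * real (2 * m' N) \<le> T * (2 * (d2 * real N / (4 * T)))"
        using fl(3) T by (intro mult_left_mono) auto
      also have "\<dots> < d2 * real N" using d2(1) T N(1) by (simp add: field_simps)
      finally have K2: "T * real (2 * m' N) / real N < d2" using N(1) by (simp add: pos_divide_less_eq)
      have "prob (V N) \<le> 6 * (\<eta> / 12) + real q * (3 * (\<eta> / (6 * real q)))"
        unfolding V_def
        by (rule grid_process.grid_modulus[OF grid_process_grid_value _ m0 q(1) qm])
          (use e \<eta> q(1) N(1) K1 K2 d1(2) d2(2) in \<open>auto intro!: grid_small_increments simp del: of_nat_mult\<close>)
      also have "\<dots> = \<eta>" using q(1) by (simp add: field_simps)
      finally show ?thesis .
    qed
    \<comment> \<open>The events \<open>V N\<close> need not be monotone in \<open>N\<close>.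
      Demanding all sufficiently fine grids at once gives an increasing sequence, and the bound
      passes to its union, which is the limit inferior of the \<open>V N\<close>.\<close>
    define B where "B = (\<lambda>P. \<Inter>N\<in>{max P N0..}. V N)"
    have B_sets: "B P \<in> sets M" for P
      unfolding B_def using V_sets by (intro sets.countable_INT) auto
    have "B P \<subseteq> V (max P N0)" for P unfolding B_def by auto
    then have B_prob: "prob (B P) \<le> \<eta>" for P
      using V_prob[of "max P N0"] finite_measure_mono[OF _ V_sets, of "B P" "max P N0"]
      by (meson max.cobounded2 order_trans)
    have "incseq B" unfolding B_def by (intro monoI INT_anti_mono) auto
    then have "(\<lambda>P. prob (B P)) \<longlonglongrightarrow> prob (\<Union>P. B P)"
      using B_sets by (intro finite_Lim_measure_incseq) auto
    then have UB: "prob (\<Union>P. B P) \<le> \<eta>"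
      by (rule LIMSEQ_le_const2) (use B_prob in auto)
    have "oscillates n (d2 / 8) (7 * e) \<subseteq> (\<Union>P. B P)"
    proof
      fix \<omega> assume "\<omega> \<in> oscillates n (d2 / 8) (7 * e)"
      then obtain s' t' where st': "s' \<in> {0..T}" "t' \<in> {0..T}" "\<bar>s' - t'\<bar> < d2 / 8"
        "7 * e < \<bar>Z n \<omega> s' - Z n \<omega> t'\<bar>" and \<omega>: "\<omega> \<in> space M"
        unfolding oscillates_def by auto
      define s where "s = min s' t'"
      define t where "t = max s' t'"
      have st: "s \<in> {0..T}" "t \<in> {0..T}" "s \<le> t" "t - s < d2 / 8" "7 * e < \<bar>Z n \<omega> t - Z n \<omega> s\<bar>"
        using st' by (auto simp: s_def t_def min_def max_def abs_minus_commute)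
      let ?g = "\<lambda>N s. T * real (grid_index N s) / real N"
      have ev1: "\<forall>\<^sub>F N in sequentially. 7 * e < \<bar>Z n \<omega> (?g N t) - Z n \<omega> (?g N s)\<bar>"
        by (rule order_tendstoD(1)[OF _ st(5)]) (intro tendsto_rabs tendsto_diff path_grid_tendsto st \<omega>)
      have "uniformly_continuous_on {0..T} (Z n \<omega>)"
        by (intro compact_uniformly_continuous cont \<omega>) simp
      then obtain d where d: "d > 0" "\<And>s t. s\<in>{0..T} \<Longrightarrow> t\<in>{0..T} \<Longrightarrow> dist s t < d \<Longrightarrow> dist (Z n \<omega> s) (Z n \<omega> t) < e"
        unfolding uniformly_continuous_on_def using e by metis
      have "(\<lambda>N. T / real N) \<longlonglongrightarrow> 0" by real_asymp
      then have ev2: "\<forall>\<^sub>F N in sequentially. T / real N < min d (d2 / 16)"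
        by (rule order_tendstoD(2)) (use d(1) d2(1) in auto)
      have "\<forall>\<^sub>F N in sequentially. \<omega> \<in> V N"
        using ev1 ev2 eventually_gt_at_top[of 0]
      proof eventually_elim
        case (elim N)
        let ?a = "grid_index N s" and ?b = "grid_index N t"
        have abN: "?a \<le> N" "?b \<le> N" using grid_index_bounds(3) st by auto
        have "s * real N / T \<le> t * real N / T" using st(3) T by (intro divide_right_mono mult_right_mono) auto
        then have ab: "?a \<le> ?b" unfolding grid_index_def by (intro nat_mono floor_mono)
        have "t * real N / T - s * real N / T = (t - s) * (real N / T)" by (simp add: diff_divide_distrib left_diff_distrib)
        also have "\<dots> \<le> (d2 / 8) * (real N / T)" using st(4) T by (intro mult_right_mono) auto
        finally have diff: "t * real N / T - s * real N / T \<le> d2 * real N / (8 * T)" by (simp add: mult.commute)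
        \<comment> \<open>With \<open>x = d2 * N / (8 * T)\<close>, the two indices differ by less
          than \<open>x + 1\<close>, and \<open>m' N > 2 * x - 1\<close>. Thus
          \<open>x \<ge> 2\<close> leaves room for both roundings, which explains the radius
          \<open>d2 / 8\<close>.\<close>
        have "2 \<le> d2 * real N / (8 * T)" using elim(2,3) T d2(1) by (simp add: field_simps)
        moreover have "d2 * real N / (4 * T) = 2 * (d2 * real N / (8 * T))" by simp
        moreover have "d2 * real N / (4 * T) < real (m' N) + 1" using d2(1) T by (simp add: m'_def)
        ultimately have "real ?b \<le> real ?a + real (m' N)"
          using diff grid_index_bounds(1)[OF st(2), of N] grid_index_bounds(2)[OF st(1), of N] by linarith
        then have abm: "?b \<le> ?a + m' N" by linarith
        have step: "\<bar>grid_value n N (Suc j) \<omega> - grid_value n N j \<omega>\<bar> \<le> e" if j: "j < N" for j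
        proof -
          have "dist (T * real (Suc j) / real N) (T * real j / real N) = T / real N"
            using T by (simp add: dist_real_def diff_divide_distrib[symmetric] algebra_simps)
          then have "dist (Z n \<omega> (T * real (Suc j) / real N)) (Z n \<omega> (T * real j / real N)) < e"
            using j elim(2) by (intro d(2) grid_point_range) auto
          then show ?thesis using j by (simp add: grid_value_eq dist_real_def del: of_nat_Suc)
        qed
        have "7 * e < \<bar>grid_value n N ?b \<omega> - grid_value n N ?a \<omega>\<bar>"
          using elim(1) abN by (simp add: grid_value_eq)
        then show ?case unfolding V_def using \<omega> step abN ab abm by blast
      qed
      then obtain P where "\<And>N. N \<ge> P \<Longrightarrow> \<omega> \<in> V N" by (auto simp: eventually_sequentially)
      then have "\<omega> \<in> B P" unfolding B_def by auto
      then show "\<omega> \<in> (\<Union>P. B P)" by blast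
    qed
    then have "prob (oscillates n (d2 / 8) (7 * e)) \<le> prob (\<Union>P. B P)"
      using B_sets by (intro finite_measure_mono) auto
    then show ?thesis using UB by simp
  qed
  then show ?thesis using d2(1) by (intro exI[of _ "d2 / 8"]) auto
qed

end

section \<open>Borel sets of a topology and a tail bound\<close>

lemma space_borel_of: "space (borel_of X) = topspace X"
  by (simp add: borel_of_def space_measure_of_conv)

lemma sets_borel_of: "sets (borel_of X) = sigma_sets (topspace X) {U. openin X U}"
  unfolding borel_of_def by (rule sets_measure_of) (auto dest: openin_subset)

lemma closedin_sets_borel_of:
  assumes "closedin X K"
  shows "K \<in> sets (borel_of X)"
proof -
  have "topspace X - K \<in> sets (borel_of X)"
    using assms unfolding sets_borel_of by (intro sigma_sets.Basic) auto
  then have "space (borel_of X) - (topspace X - K) \<in> sets (borel_of X)" by (rule sets.compl_sets)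
  then show ?thesis using closedin_subset[OF assms] by (simp add: space_borel_of double_diff)
qed

lemma openin_sets_borel_of: "openin X U \<Longrightarrow> U \<in> sets (borel_of X)"
  by (auto simp: sets_borel_of)

lemma continuous_map_measurable_borel_of:
  assumes "continuous_map X Y f"
  shows "f \<in> measurable (borel_of X) (borel_of Y)"
proof (rule measurable_sigma_sets[OF sets_borel_of])
  show "{U. openin Y U} \<subseteq> Pow (topspace Y)" by (auto dest: openin_subset)
  show "f \<in> space (borel_of X) \<rightarrow> topspace Y"
    using continuous_map_image_subset_topspace[OF assms] by (auto simp: space_borel_of)
  fix U assume "U \<in> {U. openin Y U}"
  then have "openin X {x \<in> topspace X. f x \<in> U}" using assms by (auto simp: continuous_map_def)
  moreover have "f -` U \<inter> space (borel_of X) = {x \<in> topspace X. f x \<in> U}" by (auto simp: space_borel_of)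
  ultimately show "f -` U \<inter> space (borel_of X) \<in> sets (borel_of X)" by (simp add: openin_sets_borel_of)
qed

text \<open>Markov's inequality, obtained from monotonicity of the nonnegative integral. The event
  is measurable as the preimage of a set of paths that is open in the uniform metric.\<close>

lemma (in prob_space) sup_norm_tail:
  fixes X :: "'a \<Rightarrow> real \<Rightarrow> 'h::real_normed_vector"
  assumes T: "T \<ge> 0" and R: "R > 0" and C: "C \<ge> 0"
    and X: "X \<in> measurable M (borel_of (mtopology_of (C_metric T)))"
    and bound: "(\<integral>\<^sup>+ \<omega>. (SUP t\<in>{0..T}. ennreal (norm (X \<omega> t))) \<partial>M) \<le> ennreal C"
  shows "{\<omega>\<in>space M. \<exists>t\<in>{0..T}. R < norm (X \<omega> t)} \<in> sets M" (is "?S \<in> _")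
    and "prob {\<omega>\<in>space M. \<exists>t\<in>{0..T}. R < norm (X \<omega> t)} \<le> C / R"
proof -
  define U where "U = {x \<in> mspace (C_metric T). \<exists>t\<in>{0..T}. R < norm (x t :: 'h)}"
  have "openin (mtopology_of (C_metric T)) U"
  proof (rule openin_C_metricI[OF T])
    fix x assume "x \<in> U"
    then obtain t where t: "t \<in> {0..T}" "R < norm (x t)" by (auto simp: U_def)
    have "y \<in> U" if "y \<in> mspace (C_metric T)" "\<forall>s\<in>{0..T}. dist (x s) (y s) < norm (x t) - R" for y
    proof -
      have "norm (x t) - norm (y t) \<le> dist (x t) (y t)" by (simp add: dist_norm norm_triangle_ineq2)
      then have "R < norm (y t)" using that(2) t(1) by fastforce
      then show ?thesis using that(1) t(1) by (auto simp: U_def)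
    qed
    then show "\<exists>r>0. \<forall>y\<in>mspace (C_metric T). (\<forall>s\<in>{0..T}. dist (x s) (y s) < r) \<longrightarrow> y \<in> U"
      using t(2) by (intro exI[of _ "norm (x t) - R"]) auto
  qed (auto simp: U_def)
  then have "X -` U \<inter> space M \<in> sets M" by (intro measurable_sets[OF X] openin_sets_borel_of)
  moreover have "X -` U \<inter> space M = ?S"
    using measurable_space[OF X] by (auto simp: U_def space_borel_of)
  ultimately show S: "?S \<in> sets M" by simp
  have "ennreal (R * prob ?S) = ennreal R * emeasure M ?S"
    using R by (simp add: emeasure_eq_measure ennreal_mult)
  also have "\<dots> = (\<integral>\<^sup>+ \<omega>. ennreal R * indicator ?S \<omega> \<partial>M)"
    using S by (simp add: nn_integral_cmult_indicator)
  also have "\<dots> \<le> (\<integral>\<^sup>+ \<omega>. (SUP t\<in>{0..T}. ennreal (norm (X \<omega> t))) \<partial>M)"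
  proof (rule nn_integral_mono)
    fix \<omega>
    show "ennreal R * indicator ?S \<omega> \<le> (SUP t\<in>{0..T}. ennreal (norm (X \<omega> t)))"
    proof (cases "\<omega> \<in> ?S")
      case True
      then obtain t where "t \<in> {0..T}" "R < norm (X \<omega> t)" by blast
      then have "ennreal R \<le> ennreal (norm (X \<omega> t))" "ennreal (norm (X \<omega> t)) \<le> (SUP t\<in>{0..T}. ennreal (norm (X \<omega> t)))"
        by (auto intro: ennreal_leI SUP_upper)
      then show ?thesis using True by (metis (no_types, lifting) indicator_simps(1) mult.right_neutral order_trans)
    qed simp
  qed
  also have "\<dots> \<le> ennreal C" by (rule bound)
  finally have "R * prob ?S \<le> C" using C by simp
  then show "prob ?S \<le> C / R" using R by (simp add: pos_le_divide_eq mult.commute)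
qed

section \<open>Tightness of the laws\<close>

text \<open>Differences of path values have norm at most \<open>2 * R\<close>, so the tolerance
  \<open>w m / (4 * R)\<close> costs \<open>w m / 2\<close>; the modulus against the test vectors
  uses up the other half.\<close>

lemma gelfand_path_equicontinuous:
  fixes i :: "'y::real_normed_vector \<Rightarrow>\<^sub>L 'h::real_inner"
  assumes R: "R > 0" and w: "\<And>m. w m > 0"
    and bound: "\<And>t. t \<in> {0..T} \<Longrightarrow> norm (x t) \<le> R"
    and test: "\<And>m h a. (\<And>y. y \<in> Y m \<Longrightarrow> \<bar>h \<bullet> blinfun_apply i y\<bar> \<le> a) \<Longrightarrow> a \<ge> 0 \<Longrightarrow>
      norm (gelfand_dual i h) \<le> a + w m / (4 * R) * norm h"
    and modulus: "\<And>m y s t. y \<in> Y m \<Longrightarrow> s \<in> {0..T} \<Longrightarrow> t \<in> {0..T} \<Longrightarrow> \<bar>s - t\<bar> < \<delta> m \<Longrightarrow>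
      \<bar>x s \<bullet> blinfun_apply i y - x t \<bullet> blinfun_apply i y\<bar> \<le> w m / 2"
  shows "(\<lambda>t\<in>{0..T}. gelfand_dual i (x t)) \<in>
    equicontinuous_paths T (closure (gelfand_dual i ` cball 0 R)) \<delta> w"
proof -
  have "gelfand_dual i (x t) \<in> closure (gelfand_dual i ` cball 0 R)" if "t \<in> {0..T}" for t
    using bound[OF that] by (intro subsetD[OF closure_subset] imageI) simp
  moreover have "norm (gelfand_dual i (x s) - gelfand_dual i (x t)) \<le> w m"
    if st: "s \<in> {0..T}" "t \<in> {0..T}" "\<bar>s - t\<bar> < \<delta> m" for s t m
  proof -
    have "norm (gelfand_dual i (x s - x t)) \<le> w m / 2 + w m / (4 * R) * norm (x s - x t)"
      using modulus[OF _ st] w[of m] by (intro test) (auto simp: inner_diff_left)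
    also have "norm (x s - x t) \<le> 2 * R"
      using norm_triangle_ineq4[of "x s" "x t"] bound[OF st(1)] bound[OF st(2)] by linarith
    then have "w m / (4 * R) * norm (x s - x t) \<le> w m / (4 * R) * (2 * R)"
      using w[of m] R by (intro mult_left_mono) auto
    also have "w m / (4 * R) * (2 * R) = w m / 2" using R by simp
    finally show ?thesis by (simp add: gelfand_dual_diff)
  qed
  ultimately show ?thesis by (simp add: equicontinuous_paths_def)
qed

theorem lemma3p3p2:
  fixes M :: "'a measure" and F :: "real \<Rightarrow> 'a measure"
    and i :: "'y::{banach, second_countable_topology} \<Rightarrow>\<^sub>L 'h::{real_inner, polish_space}"
    and T :: real
    and \<Psi> :: "nat \<Rightarrow> 'a \<Rightarrow> real \<Rightarrow> 'h"
  assumes "filtered_prob_space M F"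
    and "reflexive_space TYPE('y)"
    and "compact_embedding i"
    and "dense_embedding i"
    and "T > 0"
    and "\<And>n. \<Psi> n \<in> measurable M (borel_of (mtopology_of (C_metric T)))"
    and adapted: "\<And>n t. t \<in> {0..T} \<Longrightarrow> (\<lambda>\<omega>. \<Psi> n \<omega> t) \<in> borel_measurable (F t)"
    and "(SUP n. \<integral>\<^sup>+ \<omega>. (SUP t\<in>{0..T}. ennreal (norm (\<Psi> n \<omega> t))) \<partial>M) < \<infinity>"
    and "\<And>\<gamma> \<epsilon> y.
           (\<And>n. stopping_time F (\<gamma> n)) \<Longrightarrow>
           (\<And>n \<omega>. \<omega> \<in> space M \<Longrightarrow> \<gamma> n \<omega> \<in> {0..T}) \<Longrightarrow>
           \<epsilon> > 0 \<Longrightarrow>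
           ((\<lambda>\<delta>. SUP n. measure M
               {\<omega> \<in> space M.
                  \<bar>(\<Psi> n \<omega> (min (\<gamma> n \<omega> + \<delta>) T) - \<Psi> n \<omega> (\<gamma> n \<omega>)) \<bullet> blinfun_apply i y\<bar> > \<epsilon>})
             \<longlongrightarrow> 0) (at_right (0::real))"
  shows "tight_family (skorohod_topology T) (range (\<lambda>n. skorohod_law M T i (\<Psi> n)))"
proof -
  interpret filtered_prob_space M F by fact
  note meas = assms(6) and aldous = assms(9)
  have T: "T \<ge> 0" using \<open>T > 0\<close> by simp
  define G where "G = (\<lambda>x. \<lambda>t\<in>{0..T}. gelfand_dual i (x t))"
  \<comment> \<open>The oscillation event of the process tested against \<open>y\<close>, written
    out so that several \<open>y\<close> can be handled together.\<close>
  define W where "W = (\<lambda>y n \<delta> c. {\<omega>\<in>space M. \<exists>s\<in>{0..T}. \<exists>t\<in>{0..T}. \<bar>s - t\<bar> < \<delta> \<and>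
      c < \<bar>\<Psi> n \<omega> s \<bullet> blinfun_apply i y - \<Psi> n \<omega> t \<bullet> blinfun_apply i y\<bar>})"
  have cont: "continuous_on {0..T} (\<Psi> n \<omega>)" if "\<omega> \<in> space M" for n \<omega>
    using measurable_space[OF meas that] by (simp add: space_borel_of mspace_C_metric)
  have process: "continuous_processes M F T (\<lambda>n \<omega> t. \<Psi> n \<omega> t \<bullet> blinfun_apply i y)" for y
  proof
    show "T > 0" by fact
    show "continuous_on {0..T} (\<lambda>t. \<Psi> n \<omega> t \<bullet> blinfun_apply i y)" if "\<omega> \<in> space M" for n \<omega>
      using cont[OF that] by (intro continuous_intros)
    show "(\<lambda>\<omega>. \<Psi> n \<omega> t \<bullet> blinfun_apply i y) \<in> borel_measurable (F t)" if "t \<in> {0..T}" for n t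
      using adapted[OF that] by (rule borel_measurable_inner) simp
  qed
  have W_eq: "W y = continuous_processes.oscillates M T (\<lambda>n \<omega> t. \<Psi> n \<omega> t \<bullet> blinfun_apply i y)" for y
    by (intro ext) (simp add: W_def continuous_processes.oscillates_def[OF process])
  have W_sets: "W y n \<delta> c \<in> sets M" for y n \<delta> c
    unfolding W_eq by (rule continuous_processes.sets_oscillates[OF process])
  have W_modulus: "\<exists>\<delta>>0. \<forall>n. prob (W y n \<delta> c) \<le> \<eta>" if "c > 0" "\<eta> > 0" for y c \<eta>
  proof -
    interpret S: continuous_processes M F T "\<lambda>n \<omega> t. \<Psi> n \<omega> t \<bullet> blinfun_apply i y" by (rule process)
    \<comment> \<open>The modulus estimate has threshold \<open>7 * e\<close>; it is used with
      \<open>e = c / 7\<close>.\<close>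
    have "\<exists>\<delta>>0. \<forall>n. prob (S.oscillates n \<delta> (7 * (c / 7))) \<le> \<eta>"
    proof (rule S.uniform_modulus)
      fix e :: real and \<gamma> :: "nat \<Rightarrow> 'a \<Rightarrow> real" assume e: "e > 0" and \<gamma>: "\<And>n. S.time_in (\<gamma> n)"
      show "((\<lambda>\<delta>. SUP n. prob (S.lag_event n (\<gamma> n) \<delta> e)) \<longlongrightarrow> 0) (at_right 0)"
        using aldous[of \<gamma> e y] \<gamma> e by (simp add: S.time_in_def S.lag_event_def inner_diff_left)
    qed (use that in auto)
    then show ?thesis by (simp add: W_eq)
  qed
  have G_cont: "continuous_map (mtopology_of (C_metric T)) (skorohod_topology T) G"
    unfolding G_def by (rule continuous_map_gelfand_path[OF T])
  have law: "skorohod_law M T i (\<Psi> n) = distr M (borel_of (skorohod_topology T)) (\<lambda>\<omega>. G (\<Psi> n \<omega>))" for n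
    by (simp add: skorohod_law_def G_def)
  have G_meas: "(\<lambda>\<omega>. G (\<Psi> n \<omega>)) \<in> measurable M (borel_of (skorohod_topology T))" for n
    by (rule measurable_compose[OF meas continuous_map_measurable_borel_of[OF G_cont]])
  have tight: "\<exists>K. compactin (skorohod_topology T) K \<and>
      (\<forall>n. measure (skorohod_law M T i (\<Psi> n)) K > 1 - \<epsilon>)" if \<epsilon>: "\<epsilon> > 0" for \<epsilon> :: real
  proof -
    obtain C where C: "C \<ge> 0" "(SUP n. \<integral>\<^sup>+ \<omega>. (SUP t\<in>{0..T}. ennreal (norm (\<Psi> n \<omega> t))) \<partial>M) = ennreal C"
      using assms(8) by (cases "SUP n. \<integral>\<^sup>+ \<omega>. (SUP t\<in>{0..T}. ennreal (norm (\<Psi> n \<omega> t))) \<partial>M") auto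
    have C': "(\<integral>\<^sup>+ \<omega>. (SUP t\<in>{0..T}. ennreal (norm (\<Psi> n \<omega> t))) \<partial>M) \<le> ennreal C" for n
      unfolding C(2)[symmetric] by (rule SUP_upper) simp
    \<comment> \<open>Makes a path leave the ball with probability at most
      \<open>\<epsilon> / 4\<close>; \<open>C + 1\<close> keeps \<open>R\<close> positive when
      \<open>C = 0\<close>.\<close>
    define R where "R = 4 * (C + 1) / \<epsilon>"
    have R: "R > 0" "C / R \<le> \<epsilon> / 4" using C(1) \<epsilon> by (auto simp: R_def field_simps)
    define w :: "nat \<Rightarrow> real" where "w = (\<lambda>m. 1 / real (Suc m))"
    have w: "w m > 0" for m by (simp add: w_def)
    have w0: "w \<longlonglongrightarrow> 0" unfolding w_def by real_asymp
    have "\<exists>Y. finite Y \<and> (\<forall>h a. (\<forall>y\<in>Y. \<bar>h \<bullet> blinfun_apply i y\<bar> \<le> a) \<longrightarrow> a \<ge> 0 \<longrightarrow>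
        norm (gelfand_dual i h) \<le> a + w m / (4 * R) * norm h)" for m
    proof -
      have "w m / (4 * R) > 0" using w[of m] R(1) by simp
      from gelfand_dual_norm_finite_test[OF assms(3) this] show ?thesis by metis
    qed
    then obtain Y where Y: "\<And>m. finite (Y m)" "\<And>m h a. (\<And>y. y \<in> Y m \<Longrightarrow> \<bar>h \<bullet> blinfun_apply i y\<bar> \<le> a) \<Longrightarrow> a \<ge> 0 \<Longrightarrow>
        norm (gelfand_dual i h) \<le> a + w m / (4 * R) * norm h" by metis
    \<comment> \<open>Level \<open>m\<close> receives \<open>\<epsilon> / 4 * (1/2) ^ m\<close>,
      shared among its test vectors, so all levels together cost at most
      \<open>\<epsilon> / 2\<close>. With the norm bound the total is
      \<open>3/4 * \<epsilon>\<close>, which leaves the strict inequality required.\<close>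
    define \<eta> where "\<eta> = (\<lambda>m. \<epsilon> / 4 * (1/2) ^ m / (real (card (Y m)) + 1))"
    have \<eta>: "\<eta> m > 0" for m using \<epsilon> by (simp add: \<eta>_def add_nonneg_pos)
    obtain \<delta>' where \<delta>': "\<And>y m. \<delta>' y m > 0" "\<And>y m n. prob (W y n (\<delta>' y m) (w m / 2)) \<le> \<eta> m"
    proof -
      have "\<exists>\<delta>>0. \<forall>n. prob (W y n \<delta> (w m / 2)) \<le> \<eta> m" for y m
        using w[of m] \<eta>[of m] by (intro W_modulus) auto
      then show ?thesis using that by metis
    qed
    \<comment> \<open>Inserting 1 keeps the minimum meaningful when \<open>Y m\<close> is
      empty.\<close>
    define \<delta> where "\<delta> = (\<lambda>m. Min (insert 1 ((\<lambda>y. \<delta>' y m) ` Y m)))"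
    have \<delta>: "\<delta> m > 0" "y \<in> Y m \<Longrightarrow> \<delta> m \<le> \<delta>' y m" for m y
      using Y(1)[of m] \<delta>'(1) by (auto simp: \<delta>_def)
    \<comment> \<open>None of \<open>R\<close>, \<open>\<delta>\<close> and \<open>w\<close> depends
      on \<open>n\<close>, so one compact set serves all the laws.\<close>
    define K where "K = equicontinuous_paths T (closure (gelfand_dual i ` cball 0 R)) \<delta> w"
    have K: "compactin (skorohod_topology T) K"
      unfolding K_def
      by (intro compactin_equicontinuous_paths compact_closure_gelfand_dual_cball T \<delta>(1) w0 assms(3))
    \<comment> \<open>Compact sets are closed in the Hausdorff Skorohod topology, hence Borel, so
      the image measure of \<open>K\<close> is the probability of its preimage.\<close>
    then have K_sets: "K \<in> sets (borel_of (skorohod_topology T))"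
      by (intro closedin_sets_borel_of compactin_imp_closedin Hausdorff_skorohod T)
    have "measure (skorohod_law M T i (\<Psi> n)) K > 1 - \<epsilon>" for n
    proof -
      define S where "S = {\<omega>\<in>space M. \<exists>t\<in>{0..T}. R < norm (\<Psi> n \<omega> t)}"
      define D where "D = (\<lambda>m. \<Union>y\<in>Y m. W y n (\<delta>' y m) (w m / 2))"
      define A where "A = (\<lambda>\<omega>. G (\<Psi> n \<omega>)) -` K \<inter> space M"
      have S: "S \<in> sets M" "prob S \<le> \<epsilon> / 4"
        unfolding S_def
        using sup_norm_tail[OF T R(1) C(1) meas C'] order_trans[OF sup_norm_tail(2)[OF T R(1) C(1) meas C'] R(2)]
        by blast+
      have D_sets: "D m \<in> sets M" for m unfolding D_def using Y(1) W_sets by auto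
      have D_prob: "prob (D m) \<le> \<epsilon> / 4 * (1/2) ^ m" for m
      proof -
        have "prob (D m) \<le> (\<Sum>y\<in>Y m. prob (W y n (\<delta>' y m) (w m / 2)))"
          unfolding D_def by (intro measure_UNION_le Y(1) W_sets)
        also have "\<dots> \<le> (\<Sum>y\<in>Y m. \<eta> m)" by (intro sum_mono \<delta>'(2))
        also have "\<dots> = \<epsilon> / 4 * (1/2) ^ m * (real (card (Y m)) / (real (card (Y m)) + 1))" by (simp add: \<eta>_def)
        also have "\<dots> \<le> \<epsilon> / 4 * (1/2) ^ m * 1" using \<epsilon> by (intro mult_left_mono) (auto simp: divide_simps)
        finally show ?thesis by simp
      qed
      have geo: "(\<lambda>m. \<epsilon> / 4 * (1/2) ^ m) sums (\<epsilon> / 2)"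
        using sums_mult[OF geometric_sums[of "1/2::real"], of "\<epsilon> / 4"] by simp
      have summ: "summable (\<lambda>m. prob (D m))"
        by (rule summable_comparison_test'[OF sums_summable[OF geo]]) (use D_prob in auto)
      have UD: "prob (\<Union>m. D m) \<le> \<epsilon> / 2"
      proof -
        have "prob (\<Union>m. D m) \<le> (\<Sum>m. prob (D m))"
          using D_sets summ by (intro finite_measure_subadditive_countably) auto
        also have "\<dots> \<le> \<epsilon> / 2"
          using suminf_le[OF D_prob summ sums_summable[OF geo]] sums_unique[OF geo] by simp
        finally show ?thesis .
      qed
      have A_sets: "A \<in> sets M" unfolding A_def by (rule measurable_sets[OF G_meas K_sets])
      have "space M - A \<subseteq> S \<union> (\<Union>m. D m)"
      proof
        fix \<omega> assume \<omega>: "\<omega> \<in> space M - A"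
        show "\<omega> \<in> S \<union> (\<Union>m. D m)"
        proof (rule ccontr)
          assume no: "\<omega> \<notin> S \<union> (\<Union>m. D m)"
          have "G (\<Psi> n \<omega>) \<in> K"
            unfolding G_def K_def
          proof (rule gelfand_path_equicontinuous[where Y = Y])
            show "norm (\<Psi> n \<omega> t) \<le> R" if "t \<in> {0..T}" for t
              using no \<omega> that by (auto simp: S_def not_less)
            show "\<bar>\<Psi> n \<omega> s \<bullet> blinfun_apply i y - \<Psi> n \<omega> t \<bullet> blinfun_apply i y\<bar> \<le> w m / 2"
              if y: "y \<in> Y m" and st: "s \<in> {0..T}" "t \<in> {0..T}" "\<bar>s - t\<bar> < \<delta> m" for m y s t
            proof -
              have "\<omega> \<notin> W y n (\<delta>' y m) (w m / 2)" using no y by (auto simp: D_def)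
              moreover have "\<bar>s - t\<bar> < \<delta>' y m" using st(3) \<delta>(2)[OF y] by simp
              ultimately show ?thesis using \<omega> st(1,2) unfolding W_def
                by (metis (mono_tags, lifting) DiffD1 mem_Collect_eq not_less)
            qed
          qed (use R(1) w Y(2) in auto)
          then show False using \<omega> by (auto simp: A_def)
        qed
      qed
      then have "prob (space M - A) \<le> prob (S \<union> (\<Union>m. D m))"
        using S(1) D_sets by (intro finite_measure_mono) auto
      also have "\<dots> \<le> prob S + prob (\<Union>m. D m)"
        using S(1) D_sets by (intro measure_Un_le) auto
      also have "\<dots> < \<epsilon>" using S(2) UD \<epsilon> by linarith
      finally have "1 - \<epsilon> < prob A" using prob_compl[OF A_sets] by simp
      then show ?thesis unfolding law A_def by (simp add: measure_distr[OF G_meas K_sets])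
    qed
    then show ?thesis using K by blast
  qed
  have "prob_space (skorohod_law M T i (\<Psi> n))" for n
    unfolding law by (rule prob_space_distr[OF G_meas])
  then show ?thesis
    unfolding tight_family_def using tight by (auto simp: law)
qed


end
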